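(* The collection $\mathfrak{H}$ of all metric families that are coarsely embeddable into Hilbert space is stable under weak decomposition. That is, if $n$ is a non-negative integer and $\mathcal{X}$ is a metric family that is $n$-decomposable over $\mathfrak{H}$, then $\mathcal{X}$ is in $\mathfrak{H}$.
   Context: A metric family is a (countable) collection of metric spaces. Decomposition: Let $r>0$ and let $n$ be a non-negative integer. A metric family $\mathcal{X}$ is $(r,n)$-decomposable over a metric family $\mathcal{Y}$ if every $X\in\mathcal{X}$ can be written as $X=X_0\cup X_1\cup\cdots\cup X_n$ such that each $X_i$ is an $r$-disjoint union $X_i=\bigsqcup_j X_{ij}$ with each $X_{ij}$ in $\mathcal{Y}$ (subsets carry the subspace metric). Here $r$-disjoint means $d(U,V)>r$ for any two distinct members $U\ne V$ of the union. If $\mathfrak{C}$ is a collection of metric families, $\mathcal{X}$ is $n$-decomposable over $\mathfrak{C}$ if for every $r>0$ it is $(r,n)$-decomposable over some metric family $\mathcal{Y}$ in $\mathfrak{C}$. It is weakly decomposable over $\mathfrak{C}$ if it is $n$-decomposable over $\mathfrak{C}$ for some non-negative integer $n$. Coarse embeddings: A map of metric families $F:\mathcal{X}\to\mathcal{Y}$ is a collection of functions $f:X\to Y$, with $X\in\mathcal{X}$ and $Y\in\mathcal{Y}$, such that every $X\in\mathcal{X}$ is the domain of at least one $f$ in $F$. It is a coarse embedding if there exist non-decreasing functions $\delta,\rho:[0,\infty)\to[0,\infty)$ with $\lim_{t\to\infty}\delta(t)=\infty=\lim_{t\to\infty}\rho(t)$ such that for every $f:X\to Y$ in $F$ and all $x,y\in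 X$, $\delta(d_X(x,y))\le d_Y(f(x),f(y))\le\rho(d_X(x,y))$. A metric family $\mathcal{X}=\{X_\alpha\mid\alpha\in I\}$ is coarsely embeddable into Hilbert space if there are a family of Hilbert spaces $\mathcal{H}=\{H_\alpha\mid\alpha\in I\}$ and a map of metric families $F=\{F_\alpha:X_\alpha\to H_\alpha\mid\alpha\in I\}$ such that $F:\mathcal{X}\to\mathcal{H}$ is a coarse embedding. The collection of all such metric families is denoted $\mathfrak{H}$. *)

theory Defs
  imports "HOL-Analysis.Analysis"
begin

section \<open>Metric families and decomposition\<close>

definition metric_family :: "'a metric set \<Rightarrow> bool" where
  "metric_family \<X> \<longleftrightarrow> countable \<X>"

text \<open>The distance is extended real valued, so that the empty set is at distance \<open>\<infinity>\<close> from
  every set.\<close>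

definition set_distance :: "'a metric \<Rightarrow> 'a set \<Rightarrow> 'a set \<Rightarrow> ereal" where
  "set_distance X U V = (INF (x, y) \<in> U \<times> V. ereal (mdist X x y))"

definition r_disjoint :: "real \<Rightarrow> 'a metric \<Rightarrow> 'a set set \<Rightarrow> bool" where
  "r_disjoint r X \<U> \<longleftrightarrow> (\<forall>U\<in>\<U>. \<forall>V\<in>\<U>. U \<noteq> V \<longrightarrow> set_distance X U V > ereal r)"

text \<open>\<open>P i\<close> is the set of the pieces \<open>X\<^sub>i\<^sub>j\<close> whose \<open>r\<close>-disjoint union is \<open>X\<^sub>i\<close>.\<close>

definition rn_decomposable :: "real \<Rightarrow> nat \<Rightarrow> 'a metric set \<Rightarrow> 'a metric set \<Rightarrow> bool" where
  "rn_decomposable r n \<X> \<Y> \<longleftrightarrow>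
     (\<forall>X\<in>\<X>. \<exists>P :: nat \<Rightarrow> 'a set set.
        mspace X = (\<Union>i\<le>n. \<Union>(P i)) \<and>
        (\<forall>i\<le>n. r_disjoint r X (P i) \<and> (\<forall>U\<in>P i. submetric X U \<in> \<Y>)))"

definition n_decomposable :: "nat \<Rightarrow> 'a metric set \<Rightarrow> 'a metric set set \<Rightarrow> bool" where
  "n_decomposable n \<X> \<CC> \<longleftrightarrow> (\<forall>r>0. \<exists>\<Y>\<in>\<CC>. rn_decomposable r n \<X> \<Y>)"


section \<open>Maps of metric families and coarse embeddings\<close>

text \<open>A member \<open>f : X \<rightarrow> Y\<close> of a map of metric families is represented by the
  triple \<open>(X, f, Y)\<close>.\<close>

definition family_map ::
  "'a metric set \<Rightarrow> 'b metric set \<Rightarrow> ('a metric \<times> ('a \<Rightarrow> 'b) \<times> 'b metric) set \<Rightarrow> bool" where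
  "family_map \<X> \<Y> F \<longleftrightarrow>
     (\<forall>(X, f, Y)\<in>F. X \<in> \<X> \<and> Y \<in> \<Y> \<and> f \<in> mspace X \<rightarrow> mspace Y) \<and>
     (\<forall>X\<in>\<X>. \<exists>f Y. (X, f, Y) \<in> F)"

definition coarse_embedding ::
  "'a metric set \<Rightarrow> 'b metric set \<Rightarrow> ('a metric \<times> ('a \<Rightarrow> 'b) \<times> 'b metric) set \<Rightarrow> bool" where
  "coarse_embedding \<X> \<Y> F \<longleftrightarrow>
     family_map \<X> \<Y> F \<and>
     (\<exists>\<delta> \<rho> :: real \<Rightarrow> real.
        \<delta> \<in> {0..} \<rightarrow> {0..} \<and> \<rho> \<in> {0..} \<rightarrow> {0..} \<and>
        mono_on {0..} \<delta> \<and> mono_on {0..} \<rho> \<and>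
        filterlim \<delta> at_top at_top \<and> filterlim \<rho> at_top at_top \<and>
        (\<forall>(X, f, Y)\<in>F. \<forall>x\<in>mspace X. \<forall>y\<in>mspace X.
           \<delta> (mdist X x y) \<le> mdist Y (f x) (f y) \<and>
           mdist Y (f x) (f y) \<le> \<rho> (mdist X x y)))"


section \<open>Hilbert spaces on a carrier set\<close>

text \<open>The class of complete real inner product spaces cannot be used here: a family of Hilbert
  spaces has to be quantified existentially, and its members may be of different dimensions.\<close>

record 'h inner_space =
  vectors :: "'h set"
  vzero :: 'h
  vadd :: "'h \<Rightarrow> 'h \<Rightarrow> 'h"
  vscale :: "real \<Rightarrow> 'h \<Rightarrow> 'h"
  vinner :: "'h \<Rightarrow> 'h \<Rightarrow> real"

locale real_inner_space =
  fixes H :: "'h inner_space"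
  assumes zero_closed: "vzero H \<in> vectors H"
    and add_closed: "\<lbrakk>x \<in> vectors H; y \<in> vectors H\<rbrakk> \<Longrightarrow> vadd H x y \<in> vectors H"
    and scale_closed: "x \<in> vectors H \<Longrightarrow> vscale H a x \<in> vectors H"
    and add_assoc: "\<lbrakk>x \<in> vectors H; y \<in> vectors H; z \<in> vectors H\<rbrakk>
          \<Longrightarrow> vadd H (vadd H x y) z = vadd H x (vadd H y z)"
    and add_commute: "\<lbrakk>x \<in> vectors H; y \<in> vectors H\<rbrakk> \<Longrightarrow> vadd H x y = vadd H y x"
    and add_zero: "x \<in> vectors H \<Longrightarrow> vadd H x (vzero H) = x"
    and add_inverse: "x \<in> vectors H \<Longrightarrow> \<exists>y\<in>vectors H. vadd H x y = vzero H"
    and scale_add_right: "\<lbrakk>x \<in> vectors H; y \<in> vectors H\<rbrakk>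
          \<Longrightarrow> vscale H a (vadd H x y) = vadd H (vscale H a x) (vscale H a y)"
    and scale_add_left: "x \<in> vectors H
          \<Longrightarrow> vscale H (a + b) x = vadd H (vscale H a x) (vscale H b x)"
    and scale_scale: "x \<in> vectors H \<Longrightarrow> vscale H a (vscale H b x) = vscale H (a * b) x"
    and scale_one: "x \<in> vectors H \<Longrightarrow> vscale H 1 x = x"
    and inner_commute: "\<lbrakk>x \<in> vectors H; y \<in> vectors H\<rbrakk> \<Longrightarrow> vinner H x y = vinner H y x"
    and inner_add_left: "\<lbrakk>x \<in> vectors H; y \<in> vectors H; z \<in> vectors H\<rbrakk>
          \<Longrightarrow> vinner H (vadd H x y) z = vinner H x z + vinner H y z"
    and inner_scale_left: "\<lbrakk>x \<in> vectors H; y \<in> vectors H\<rbrakk>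
          \<Longrightarrow> vinner H (vscale H a x) y = a * vinner H x y"
    and inner_nonneg: "x \<in> vectors H \<Longrightarrow> 0 \<le> vinner H x x"
    and inner_eq_zero: "\<lbrakk>x \<in> vectors H; vinner H x x = 0\<rbrakk> \<Longrightarrow> x = vzero H"

definition vdiff :: "'h inner_space \<Rightarrow> 'h \<Rightarrow> 'h \<Rightarrow> 'h" where
  "vdiff H x y = vadd H x (vscale H (-1) y)"

text \<open>\<^locale>\<open>Metric_space\<close> asks for symmetry and nonnegativity also off the carrier, hence the
  default value \<open>0\<close> there.\<close>

definition vdist :: "'h inner_space \<Rightarrow> 'h \<Rightarrow> 'h \<Rightarrow> real" where
  "vdist H x y =
     (if x \<in> vectors H \<and> y \<in> vectors H then sqrt (vinner H (vdiff H x y) (vdiff H x y)) else 0)"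

definition inner_metric :: "'h inner_space \<Rightarrow> 'h metric" where
  "inner_metric H = metric (vectors H, vdist H)"

locale real_hilbert_space = real_inner_space H for H :: "'h inner_space" +
  assumes complete: "mcomplete_of (inner_metric H)"

context real_inner_space
begin

lemma scale_zero_left: "x \<in> vectors H \<Longrightarrow> vscale H 0 x = vzero H"
  using inner_scale_left[of x "vscale H 0 x" 0] by (simp add: inner_eq_zero scale_closed)

lemma diff_closed: "\<lbrakk>x \<in> vectors H; y \<in> vectors H\<rbrakk> \<Longrightarrow> vdiff H x y \<in> vectors H"
  by (simp add: vdiff_def add_closed scale_closed)

lemma inner_diff_left:
  "\<lbrakk>x \<in> vectors H; y \<in> vectors H; z \<in> vectors H\<rbrakk>
    \<Longrightarrow> vinner H (vdiff H x y) z = vinner H x z - vinner H y z"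
  by (simp add: vdiff_def inner_add_left inner_scale_left scale_closed)

lemma inner_diff_right:
  "\<lbrakk>x \<in> vectors H; y \<in> vectors H; z \<in> vectors H\<rbrakk>
    \<Longrightarrow> vinner H z (vdiff H x y) = vinner H z x - vinner H z y"
  by (metis diff_closed inner_commute inner_diff_left)

lemma inner_zero_left: "x \<in> vectors H \<Longrightarrow> vinner H (vzero H) x = 0"
  by (metis inner_scale_left mult_zero_left scale_zero_left)

lemma diff_eq_zero:
  assumes "x \<in> vectors H" "y \<in> vectors H" "vdiff H x y = vzero H"
  shows "x = y"
proof -
  have "vadd H (vscale H (-1) y) y = vzero H"
    using scale_add_left[of y "-1" 1] assms by (simp add: scale_one scale_zero_left)
  then have "x = vadd H x (vadd H (vscale H (-1) y) y)"
    using assms by (simp add: add_zero)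
  also have "\<dots> = vadd H (vdiff H x y) y"
    using assms(1,2) by (simp add: vdiff_def add_assoc scale_closed)
  also have "\<dots> = y"
    using assms by (metis add_commute add_zero zero_closed)
  finally show ?thesis .
qed

lemma cauchy_schwarz:
  assumes x: "x \<in> vectors H" and y: "y \<in> vectors H"
  shows "\<bar>vinner H x y\<bar> \<le> sqrt (vinner H x x) * sqrt (vinner H y y)"
proof -
  have *: "0 \<le> vinner H x x - 2 * t * vinner H x y + t\<^sup>2 * vinner H y y" for t
  proof -
    define z where "z = vscale H t y"
    have z: "z \<in> vectors H" by (simp add: z_def y scale_closed)
    have xz: "vinner H x z = t * vinner H x y"
      by (metis inner_commute inner_scale_left x y z z_def)
    have zz: "vinner H z z = t\<^sup>2 * vinner H y y"
      by (metis (no_types, lifting) inner_commute inner_scale_left mult.assoc power2_eq_square y z z_def)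
    have "0 \<le> vinner H (vdiff H x z) (vdiff H x z)"
      by (simp add: diff_closed inner_nonneg x z)
    also have "\<dots> = vinner H x x - 2 * vinner H x z + vinner H z z"
      using x z by (simp add: inner_diff_left inner_diff_right diff_closed inner_commute[of z x])
    finally show ?thesis by (simp add: xz zz)
  qed
  have "(vinner H x y)\<^sup>2 \<le> vinner H x x * vinner H y y"
  proof (cases "vinner H y y = 0")
    case True
    then have "vinner H x y = 0"
      using inner_eq_zero[OF y] by (metis inner_commute inner_zero_left x y)
    then show ?thesis by (simp add: True)
  next
    case False
    then have pos: "vinner H y y > 0" using inner_nonneg[OF y] by simp
    show ?thesis
      using *[of "vinner H x y / vinner H y y"] pos
      by (simp add: field_simps power2_eq_square)
  qed
  then show ?thesis
    by (metis real_sqrt_abs real_sqrt_le_iff real_sqrt_mult)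
qed

lemma vdist_square:
  assumes "x \<in> vectors H" "y \<in> vectors H"
  shows "(vdist H x y)\<^sup>2 = vinner H x x - 2 * vinner H x y + vinner H y y"
  using assms inner_nonneg[of "vdiff H x y"]
  by (simp add: vdist_def inner_diff_left inner_diff_right diff_closed inner_commute[of y x])

lemma Metric_space_vdist: "Metric_space (vectors H) (vdist H)"
proof
  show "0 \<le> vdist H x y" for x y
    by (simp add: vdist_def diff_closed inner_nonneg)
  then show "vdist H x y = vdist H y x" for x y
  proof (cases "x \<in> vectors H \<and> y \<in> vectors H")
    case True
    then have "(vdist H x y)\<^sup>2 = (vdist H y x)\<^sup>2"
      by (simp add: vdist_square inner_commute[of y x])
    then show ?thesis
      using \<open>\<And>x y. 0 \<le> vdist H x y\<close> by (simp add: power2_eq_iff_nonneg)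
  qed (auto simp: vdist_def)
  show "vdist H x y = 0 \<longleftrightarrow> x = y" if "x \<in> vectors H" "y \<in> vectors H" for x y
  proof
    show "x = y" if "vdist H x y = 0"
      using that \<open>x \<in> _\<close> \<open>y \<in> _\<close>
      by (auto simp: vdist_def intro!: diff_eq_zero inner_eq_zero diff_closed)
    show "vdist H x y = 0" if "x = y"
      using vdist_square[of x x] that \<open>x \<in> _\<close> by simp
  qed
  show "vdist H x z \<le> vdist H x y + vdist H y z"
    if [simp]: "x \<in> vectors H" "y \<in> vectors H" "z \<in> vectors H" for x y z
  proof (rule power2_le_imp_le)
    have "vinner H (vdiff H x y) (vdiff H y z) \<le> vdist H x y * vdist H y z"
      using cauchy_schwarz[of "vdiff H x y" "vdiff H y z"] by (simp add: diff_closed vdist_def)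
    then have "(vdist H x z)\<^sup>2 \<le> (vdist H x y)\<^sup>2 + 2 * (vdist H x y * vdist H y z) + (vdist H y z)\<^sup>2"
      by (simp add: vdist_square inner_diff_left inner_diff_right diff_closed inner_commute[of z x]
          inner_commute[of z y] inner_commute[of y x])
    then show "(vdist H x z)\<^sup>2 \<le> (vdist H x y + vdist H y z)\<^sup>2"
      by (simp add: power2_sum)
  qed (simp add: \<open>\<And>x y. 0 \<le> vdist H x y\<close>)
qed

lemma mspace_inner_metric [simp]: "mspace (inner_metric H) = vectors H"
  by (simp add: inner_metric_def Metric_space.mspace_metric Metric_space_vdist)

lemma mdist_inner_metric [simp]: "mdist (inner_metric H) = vdist H"
  by (simp add: inner_metric_def Metric_space.mdist_metric Metric_space_vdist)

end


section \<open>Coarse embeddability into Hilbert space\<close>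

text \<open>\<open>\<H> X\<close> is the Hilbert space belonging to the member \<open>X\<close> of the family, and
  \<open>f X\<close> is the map from \<open>X\<close> to it.\<close>

definition hilbert_coarse_embedding ::
  "'a metric set \<Rightarrow> ('a metric \<Rightarrow> 'h inner_space) \<Rightarrow> ('a metric \<Rightarrow> 'a \<Rightarrow> 'h) \<Rightarrow> bool" where
  "hilbert_coarse_embedding \<X> \<H> f \<longleftrightarrow>
     (\<forall>X\<in>\<X>. real_hilbert_space (\<H> X)) \<and>
     coarse_embedding \<X> ((\<lambda>X. inner_metric (\<H> X)) ` \<X>) ((\<lambda>X. (X, f X, inner_metric (\<H> X))) ` \<X>)"

text \<open>A definition cannot quantify existentially over the type of the vectors, so this type is fixed
  to be \<^typ>\<open>'a \<Rightarrow> real\<close>. This is no restriction: the lemma \<open>in_hilbert_familiesI\<close> below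
  shows that coarse embeddings into Hilbert spaces with vectors of any type \<open>'h\<close> give the same
  collection.\<close>

definition hilbert_families :: "'a metric set set" where
  "hilbert_families =
     {\<X>. metric_family \<X> \<and>
          (\<exists>(\<H> :: 'a metric \<Rightarrow> ('a \<Rightarrow> real) inner_space) f. hilbert_coarse_embedding \<X> \<H> f)}"

text \<open>The double orthogonal complement of the range of \<open>g\<close> is a Hilbert space, and
  \<open>v \<mapsto> (\<lambda>x. \<langle>v, g x\<rangle>)\<close> is injective on it.\<close>

lemma (in real_hilbert_space) transport_to_functions:
  fixes g :: "'a \<Rightarrow> 'h"
  assumes g: "\<And>x. g x \<in> vectors H"
  obtains K :: "('a \<Rightarrow> real) inner_space" and k where
    "real_hilbert_space K" "\<And>x. k x \<in> vectors K" "\<And>x y. vdist K (k x) (k y) = vdist H (g x) (g y)"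
proof -
  define M where "M = {v \<in> vectors H. \<forall>w\<in>vectors H. (\<forall>x. vinner H w (g x) = 0) \<longrightarrow> vinner H v w = 0}"
  define \<Phi> where "\<Phi> v = (\<lambda>x. vinner H v (g x))" for v
  have MH: "v \<in> vectors H" if "v \<in> M" for v using that by (simp add: M_def)
  have gM: "g x \<in> M" for x by (auto simp: M_def g inner_commute)
  have M0: "vzero H \<in> M" by (simp add: M_def zero_closed inner_zero_left)
  have Madd: "vadd H v w \<in> M" if "v \<in> M" "w \<in> M" for v w
    using that by (simp add: M_def add_closed inner_add_left)
  have Mscale: "vscale H a v \<in> M" if "v \<in> M" for v a
    using that by (simp add: M_def scale_closed inner_scale_left)
  have Mdiff: "vdiff H v w \<in> M" if "v \<in> M" "w \<in> M" for v w
    by (simp add: vdiff_def Madd Mscale that)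
  have inj: "inj_on \<Phi> M"
  proof (rule inj_onI)
    fix v w assume v: "v \<in> M" and w: "w \<in> M" and eq: "\<Phi> v = \<Phi> w"
    have d: "vdiff H v w \<in> M" by (simp add: Mdiff v w)
    have "vinner H (vdiff H v w) (g x) = 0" for x
      using fun_cong[OF eq, of x] by (simp add: \<Phi>_def inner_diff_left MH v w g)
    with d have "vinner H (vdiff H v w) (vdiff H v w) = 0" by (auto simp: M_def)
    then have "vdiff H v w = vzero H"
      by (rule inner_eq_zero[OF MH[OF d]])
    then show "v = w"
      by (rule diff_eq_zero[OF MH[OF v] MH[OF w]])
  qed
  define \<Psi> where "\<Psi> = inv_into M \<Phi>"
  have \<Psi> [simp]: "\<Psi> (\<Phi> v) = v" if "v \<in> M" for v
    by (simp add: \<Psi>_def inj that)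
  define K where "K = \<lparr>vectors = \<Phi> ` M, vzero = (\<lambda>x. 0), vadd = (\<lambda>p q x. p x + q x),
    vscale = (\<lambda>a p x. a * p x), vinner = (\<lambda>p q. vinner H (\<Psi> p) (\<Psi> q))\<rparr>"
  have vectors_K: "vectors K = \<Phi> ` M" by (simp add: K_def)
  have \<Phi>0: "\<Phi> (vzero H) = (\<lambda>x. 0)" by (simp add: \<Phi>_def inner_zero_left g)
  have \<Phi>add: "(\<lambda>x. \<Phi> v x + \<Phi> w x) = \<Phi> (vadd H v w)" if "v \<in> M" "w \<in> M" for v w
    using that by (simp add: \<Phi>_def inner_add_left MH g)
  have \<Phi>scale: "(\<lambda>x. a * \<Phi> v x) = \<Phi> (vscale H a v)" if "v \<in> M" for v a
    using that by (simp add: \<Phi>_def inner_scale_left MH g)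
  interpret K: real_inner_space K
  proof
    show "vzero K \<in> vectors K" using M0 \<Phi>0 by (force simp: K_def)
    show "vadd K x y \<in> vectors K" if "x \<in> vectors K" "y \<in> vectors K" for x y
      using that by (auto simp: K_def \<Phi>add Madd)
    show "vscale K a x \<in> vectors K" if "x \<in> vectors K" for x a
      using that by (auto simp: K_def \<Phi>scale Mscale)
    show "\<exists>y\<in>vectors K. vadd K x y = vzero K" if x: "x \<in> vectors K" for x
    proof
      show "vscale K (-1) x \<in> vectors K"
        using x \<Phi>scale[of _ "-1"] by (auto simp: K_def Mscale)
    qed (simp add: K_def)
    show "vinner K (vadd K x y) z = vinner K x z + vinner K y z"
      if "x \<in> vectors K" "y \<in> vectors K" "z \<in> vectors K" for x y z
      using that by (auto simp: K_def \<Phi>add Madd inner_add_left MH)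
    show "vinner K (vscale K a x) y = a * vinner K x y"
      if "x \<in> vectors K" "y \<in> vectors K" for x y a
      using that by (auto simp: K_def \<Phi>scale Mscale inner_scale_left MH)
    show "x = vzero K" if x: "x \<in> vectors K" and 0: "vinner K x x = 0" for x
    proof -
      obtain v where "v \<in> M" "x = \<Phi> v" using x by (auto simp: K_def)
      with 0 have "vinner H v v = 0" by (simp add: K_def)
      then have "v = vzero H" by (rule inner_eq_zero[OF MH[OF \<open>v \<in> M\<close>]])
      then show ?thesis by (simp add: K_def \<Phi>0 \<open>x = \<Phi> v\<close>)
    qed
    show "vinner K x y = vinner K y x" if "x \<in> vectors K" "y \<in> vectors K" for x y
      using that inner_commute[OF MH MH] by (auto simp: K_def)
  qed (auto simp: K_def algebra_simps MH inner_nonneg)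
  have dist: "vdist K (\<Phi> v) (\<Phi> w) = vdist H v w" if "v \<in> M" "w \<in> M" for v w
  proof -
    have "vdiff K (\<Phi> v) (\<Phi> w) = \<Phi> (vdiff H v w)"
      using that
      by (simp add: K_def vdiff_def Mscale flip: \<Phi>scale \<Phi>add)
    then show ?thesis
      using that by (simp add: vdist_def MH Mdiff) (auto simp: K_def Mdiff)
  qed
  interpret HM: Metric_space "vectors H" "vdist H" by (rule Metric_space_vdist)
  interpret KM: Metric_space "vectors K" "vdist K" by (rule K.Metric_space_vdist)
  have "KM.mcomplete"
    unfolding KM.mcomplete_def
  proof (intro strip)
    fix \<sigma> assume \<sigma>: "KM.MCauchy \<sigma>"
    then have "\<sigma> n \<in> vectors K" for n
      unfolding KM.MCauchy_def by blast
    then have "\<exists>v\<in>M. \<sigma> n = \<Phi> v" for n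
      using vectors_K by blast
    then obtain s where s: "\<And>n. s n \<in> M" "\<And>n. \<sigma> n = \<Phi> (s n)" by metis
    have "HM.MCauchy s"
      using \<sigma> s by (auto simp: KM.MCauchy_def HM.MCauchy_def dist MH)
    moreover have "HM.mcomplete"
      using complete by (simp add: inner_metric_def HM.mcomplete_of)
    ultimately obtain l where l: "limitin HM.mtopology s l sequentially"
      by (auto simp: HM.mcomplete_def)
    then have lH: "l \<in> vectors H" by (simp add: HM.limit_metric_sequentially)
    have lim0: "(\<lambda>n. vdist H (s n) l) \<longlonglongrightarrow> 0"
      using l by (simp add: HM.limitin_metric_dist_null)
    have "vinner H l w = 0" if w: "w \<in> vectors H" and 0: "\<And>x. vinner H w (g x) = 0" for w
    proof -
      have "\<bar>vinner H l w\<bar> \<le> vdist H (s n) l * sqrt (vinner H w w)" for n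
      proof -
        have "vinner H (s n) w = 0" using s(1)[of n] w 0 by (simp add: M_def)
        then have "\<bar>vinner H l w\<bar> = \<bar>vinner H (vdiff H (s n) l) w\<bar>"
          using w lH s(1) by (simp add: inner_diff_left MH)
        also have "\<dots> \<le> vdist H (s n) l * sqrt (vinner H w w)"
          using cauchy_schwarz[of "vdiff H (s n) l" w] w lH s(1) by (simp add: vdist_def MH diff_closed)
        finally show ?thesis .
      qed
      moreover have "(\<lambda>n. vdist H (s n) l * sqrt (vinner H w w)) \<longlonglongrightarrow> 0"
        using tendsto_mult_left_zero[OF lim0] .
      ultimately have "\<bar>vinner H l w\<bar> \<le> 0"
        by (intro LIMSEQ_le_const) auto
      then show ?thesis by simp
    qed
    with lH have lM: "l \<in> M" by (simp add: M_def)
    have "limitin KM.mtopology \<sigma> (\<Phi> l) sequentially"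
      unfolding KM.limitin_metric_dist_null
      using lim0 lM s by (auto simp: dist vectors_K)
    then show "\<exists>x. limitin KM.mtopology \<sigma> x sequentially" by (rule exI[where x = "\<Phi> l"])
  qed
  then have "real_hilbert_space K"
    by (intro real_hilbert_space.intro K.real_inner_space_axioms real_hilbert_space_axioms.intro)
      (simp add: inner_metric_def KM.mcomplete_of)
  moreover have "\<Phi> (g x) \<in> vectors K" for x by (simp add: K_def gM)
  ultimately show thesis
    using that[of K "\<lambda>x. \<Phi> (g x)"] by (simp add: dist gM)
qed

lemma in_hilbert_familiesI:
  fixes \<X> :: "'a metric set" and \<H> :: "'a metric \<Rightarrow> 'h inner_space"
  assumes "metric_family \<X>" and emb: "hilbert_coarse_embedding \<X> \<H> f"
  shows "\<X> \<in> hilbert_families"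
proof -
  have hil: "real_hilbert_space (\<H> X)" if "X \<in> \<X>" for X
    using emb that by (simp add: hilbert_coarse_embedding_def)
  have met: "mspace (inner_metric (\<H> X)) = vectors (\<H> X)"
    "mdist (inner_metric (\<H> X)) = vdist (\<H> X)" if "X \<in> \<X>" for X
    using hil[OF that, THEN real_hilbert_space.axioms(1)]
    by (simp_all add: real_inner_space.mspace_inner_metric real_inner_space.mdist_inner_metric)
  have "f X \<in> mspace X \<rightarrow> mspace (inner_metric (\<H> X))" if "X \<in> \<X>" for X
    using emb that unfolding hilbert_coarse_embedding_def coarse_embedding_def family_map_def by auto
  with met have into: "f X \<in> mspace X \<rightarrow> vectors (\<H> X)" if "X \<in> \<X>" for X
    using that by simp
  have "\<exists>(K :: ('a \<Rightarrow> real) inner_space) k. real_hilbert_space K \<and> (\<forall>x\<in>mspace X. k x \<in> vectors K) \<and>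
      (\<forall>x\<in>mspace X. \<forall>y\<in>mspace X. vdist K (k x) (k y) = vdist (\<H> X) (f X x) (f X y))"
    if X: "X \<in> \<X>" for X
  proof -
    interpret real_hilbert_space "\<H> X" by (rule hil[OF X])
    define g where "g x = (if x \<in> mspace X then f X x else vzero (\<H> X))" for x
    have "g x \<in> vectors (\<H> X)" for x
      using into[OF X] by (auto simp: g_def zero_closed)
    then obtain K :: "('a \<Rightarrow> real) inner_space" and k where K: "real_hilbert_space K" "\<And>x. k x \<in> vectors K"
      "\<And>x y. vdist K (k x) (k y) = vdist (\<H> X) (g x) (g y)"
      using transport_to_functions[of g] by blast
    show ?thesis
      by (intro exI[of _ K] exI[of _ k]) (simp add: K g_def)
  qed
  then obtain K :: "'a metric \<Rightarrow> ('a \<Rightarrow> real) inner_space" and k where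
    K: "\<And>X. X \<in> \<X> \<Longrightarrow> real_hilbert_space (K X)"
    and k: "\<And>X x. \<lbrakk>X \<in> \<X>; x \<in> mspace X\<rbrakk> \<Longrightarrow> k X x \<in> vectors (K X)"
    and d: "\<And>X x y. \<lbrakk>X \<in> \<X>; x \<in> mspace X; y \<in> mspace X\<rbrakk>
        \<Longrightarrow> vdist (K X) (k X x) (k X y) = vdist (\<H> X) (f X x) (f X y)"
    by metis
  have metK: "mspace (inner_metric (K X)) = vectors (K X)"
    "mdist (inner_metric (K X)) = vdist (K X)" if "X \<in> \<X>" for X
    using K[OF that, THEN real_hilbert_space.axioms(1)]
    by (simp_all add: real_inner_space.mspace_inner_metric real_inner_space.mdist_inner_metric)
  have "family_map \<X> ((\<lambda>X. inner_metric (K X)) ` \<X>) ((\<lambda>X. (X, k X, inner_metric (K X))) ` \<X>)"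
    using k by (auto simp: family_map_def metK)
  moreover have "mdist (inner_metric (K X)) (k X x) (k X y) = mdist (inner_metric (\<H> X)) (f X x) (f X y)"
    if "X \<in> \<X>" "x \<in> mspace X" "y \<in> mspace X" for X x y
    using that by (simp add: met metK d)
  ultimately have "hilbert_coarse_embedding \<X> K k"
    using emb K by (simp add: hilbert_coarse_embedding_def coarse_embedding_def)
  with assms(1) show ?thesis
    by (auto simp: hilbert_families_def)
qed

end

theory Submission
  imports Defs "HOL-Library.Function_Algebras" "HOL-Real_Asymp.Real_Asymp"
begin

text \<open>
  The proof replaces maps into Hilbert spaces by positive definite kernels. A kernel \<open>G\<close> on a set
  is the Gram kernel of some map \<open>\<xi>\<close> into a Hilbert space, and the only thing that matters about
  \<open>\<xi>\<close> is \<open>\<parallel>\<xi> x - \<xi> y\<parallel>\<^sup>2 = G x x - 2 * G x y + G y y\<close>, the \<^emph>\<open>squared distance\<close> of \<open>G\<close>. Kernels can be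
  added, multiplied pointwise, cut off and passed to the limit, which makes it easy to glue them.

  The criterion \<open>in_hilbert_families_kernelsI\<close> reduces membership in the collection to a local
  question. Suppose that for all \<open>R\<close> and \<open>e\<close> every space of the family carries a kernel whose squared
  distance is at most \<open>e\<close> for points within \<open>R\<close>, at least \<open>1\<close> for points further apart than some \<open>T\<close>
  that does not depend on the space, and bounded by a fixed constant. Take such
  kernels for \<open>R = m + 1\<close>, \<open>e = 2\<^sup>-\<^sup>m\<close> and add up their squared distances over all \<open>m\<close>. At points
  at distance \<open>d\<close> all but about \<open>d\<close> terms are at most \<open>2\<^sup>-\<^sup>m\<close>, so the sum is finite and controlled
  from above by \<open>d\<close>; it is at least the number of \<open>m\<close> with \<open>T m \<le> d\<close>, so it is controlled from below
  as well. The sum is the squared distance of a kernel again, and \<open>kernel_hilbert_space\<close> turns it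
  into a map to a Hilbert space.

  The kernels required by the criterion come from the decomposition (\<open>decomposition_kernel\<close>). Let
  \<open>X = X\<^sub>0 \<union> \<dots> \<union> X\<^sub>n\<close>, each \<open>X\<^sub>i\<close> an \<open>r\<close>-disjoint union of pieces that are embedded uniformly by maps
  \<open>F\<close>. Let \<open>g\<^sub>i\<close> be a function with values in \<open>[0, 1]\<close> that is \<open>1\<close> on \<open>X\<^sub>i\<close>, vanishes at
  distance \<open>s\<close> or more from \<open>X\<^sub>i\<close> and is \<open>1/s\<close>-Lipschitz. A point \<open>x\<close> with \<open>g\<^sub>i x > 0\<close> has a companion \<open>p x\<close>
  within \<open>s\<close> of it in a piece \<open>J x\<close> of \<open>X\<^sub>i\<close>. Put
  \<open>G x y = (\<Sum>i\<le>n. g\<^sub>i x * g\<^sub>i y * k\<^sub>i x y)\<close>, where \<open>k\<^sub>i x y\<close> is \<open>exp (- t * \<parallel>F (p x) - F (p y)\<parallel>\<^sup>2)\<close> if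
  \<open>J x = J y\<close> and \<open>0\<close> otherwise. With \<open>r = R + 2 * s\<close>, if \<open>x\<close> and \<open>y\<close> within \<open>R\<close> of each
  other have companions in \<open>X\<^sub>i\<close>, these lie in the same piece, so a large \<open>s\<close> and then a small \<open>t\<close> make the squared distance small at scale \<open>R\<close>. For
  points far apart every \<open>k\<^sub>i x y\<close> is nearly \<open>0\<close>, while \<open>G x x \<ge> 1\<close> because \<open>x\<close> lies in some \<open>X\<^sub>i\<close>;
  hence the squared distance is at least \<open>1\<close> there.
\<close>

section \<open>Positive definite kernels\<close>

definition positive_kernel_on :: "'a set \<Rightarrow> ('a \<Rightarrow> 'a \<Rightarrow> real) \<Rightarrow> bool" where
  "positive_kernel_on S K \<longleftrightarrow>
     (\<forall>x\<in>S. \<forall>y\<in>S. K x y = K y x) \<and>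
     (\<forall>A c. finite A \<longrightarrow> A \<subseteq> S \<longrightarrow> 0 \<le> (\<Sum>x\<in>A. \<Sum>y\<in>A. c x * c y * K x y))"

lemma positive_kernel_onI:
  assumes "\<And>x y. \<lbrakk>x \<in> S; y \<in> S\<rbrakk> \<Longrightarrow> K x y = K y x"
    and "\<And>A c. \<lbrakk>finite A; A \<subseteq> S\<rbrakk> \<Longrightarrow> 0 \<le> (\<Sum>x\<in>A. \<Sum>y\<in>A. c x * c y * K x y)"
  shows "positive_kernel_on S K"
  using assms unfolding positive_kernel_on_def by blast

lemma positive_kernel_on_sym:
  "\<lbrakk>positive_kernel_on S K; x \<in> S; y \<in> S\<rbrakk> \<Longrightarrow> K x y = K y x"
  unfolding positive_kernel_on_def by blast

lemma positive_kernel_on_nonneg: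
  "\<lbrakk>positive_kernel_on S K; finite A; A \<subseteq> S\<rbrakk> \<Longrightarrow> 0 \<le> (\<Sum>x\<in>A. \<Sum>y\<in>A. c x * c y * K x y)"
  unfolding positive_kernel_on_def by blast

lemma positive_kernel_on_subset:
  "\<lbrakk>positive_kernel_on S K; T \<subseteq> S\<rbrakk> \<Longrightarrow> positive_kernel_on T K"
  unfolding positive_kernel_on_def by blast

lemma positive_kernel_on_empty: "positive_kernel_on {} K"
  by (rule positive_kernel_onI) simp_all

lemma positive_kernel_on_cong:
  assumes K: "positive_kernel_on S K" and eq: "\<And>x y. \<lbrakk>x \<in> S; y \<in> S\<rbrakk> \<Longrightarrow> K x y = L x y"
  shows "positive_kernel_on S L"
proof (rule positive_kernel_onI)
  show "L x y = L y x" if "x \<in> S" "y \<in> S" for x y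
    using positive_kernel_on_sym[OF K that] eq that by simp
next
  fix A and c :: "'a \<Rightarrow> real" assume A: "finite A" "A \<subseteq> S"
  have "(\<Sum>x\<in>A. \<Sum>y\<in>A. c x * c y * L x y) = (\<Sum>x\<in>A. \<Sum>y\<in>A. c x * c y * K x y)"
    using A by (intro sum.cong refl) (simp add: eq subset_iff)
  then show "0 \<le> (\<Sum>x\<in>A. \<Sum>y\<in>A. c x * c y * L x y)"
    using positive_kernel_on_nonneg[OF K A] by simp
qed

text \<open>Letting \<open>g\<close> vanish outside \<open>S\<close> extends a kernel by zero to a larger set. This is how kernels that
  make sense only near one layer of the decomposition become kernels on the whole space.\<close>

lemma positive_kernel_on_scale:
  assumes K: "positive_kernel_on S K" and g: "\<And>x. x \<in> T - S \<Longrightarrow> g x = 0"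
  shows "positive_kernel_on T (\<lambda>x y. g x * g y * K x y)"
proof (rule positive_kernel_onI)
  fix x y assume "x \<in> T" "y \<in> T"
  then show "g x * g y * K x y = g y * g x * K y x"
    using g positive_kernel_on_sym[OF K, of x y] by (cases "x \<in> S \<and> y \<in> S") auto
next
  fix A c assume A: "finite A" "A \<subseteq> T"
  have "(\<Sum>x\<in>A. \<Sum>y\<in>A. c x * c y * (g x * g y * K x y))
      = (\<Sum>x\<in>A \<inter> S. \<Sum>y\<in>A \<inter> S. (c x * g x) * (c y * g y) * K x y)"
    using A g
    by (intro sum.mono_neutral_cong_right ballI)
      (auto simp: mult_ac subset_iff intro!: sum.mono_neutral_cong_right sum.neutral)
  also have "\<dots> \<ge> 0"
    using positive_kernel_on_nonneg[OF K, of "A \<inter> S" "\<lambda>x. c x * g x"] A by simp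
  finally show "0 \<le> (\<Sum>x\<in>A. \<Sum>y\<in>A. c x * c y * (g x * g y * K x y))" .
qed

lemma positive_kernel_on_const:
  assumes "0 \<le> a" shows "positive_kernel_on S (\<lambda>x y. a)"
proof (rule positive_kernel_onI)
  fix A :: "'a set" and c :: "'a \<Rightarrow> real"
  have "(\<Sum>x\<in>A. \<Sum>y\<in>A. c x * c y * a) = (\<Sum>x\<in>A. c x)\<^sup>2 * a"
    by (simp only: power2_eq_square sum_product sum_distrib_right[symmetric])
  then show "0 \<le> (\<Sum>x\<in>A. \<Sum>y\<in>A. c x * c y * a)" using assms by simp
qed simp

lemma positive_kernel_on_add:
  assumes "positive_kernel_on S K" "positive_kernel_on S L"
  shows "positive_kernel_on S (\<lambda>x y. K x y + L x y)"
  using assms unfolding positive_kernel_on_def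
  by (simp add: distrib_left sum.distrib)

lemma positive_kernel_on_sum:
  assumes "\<And>i. i \<in> I \<Longrightarrow> positive_kernel_on S (K i)"
  shows "positive_kernel_on S (\<lambda>x y. \<Sum>i\<in>I. K i x y)"
  using assms
proof (induction I rule: infinite_finite_induct)
  case (insert i I)
  then show ?case by (simp add: positive_kernel_on_add)
qed (simp_all add: positive_kernel_on_const)

lemma positive_kernel_on_limit:
  assumes K: "\<And>n. positive_kernel_on S (K n)"
    and lim: "\<And>x y. \<lbrakk>x \<in> S; y \<in> S\<rbrakk> \<Longrightarrow> (\<lambda>n. K n x y) \<longlonglongrightarrow> L x y"
  shows "positive_kernel_on S L"
proof (rule positive_kernel_onI)
  fix x y assume "x \<in> S" "y \<in> S"
  moreover have "(\<lambda>n. K n x y) = (\<lambda>n. K n y x)"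
    using positive_kernel_on_sym[OF K] calculation by blast
  ultimately show "L x y = L y x" by (metis LIMSEQ_unique lim)
next
  fix A c assume A: "finite A" "A \<subseteq> S"
  have "(\<lambda>n. \<Sum>x\<in>A. \<Sum>y\<in>A. c x * c y * K n x y) \<longlonglongrightarrow> (\<Sum>x\<in>A. \<Sum>y\<in>A. c x * c y * L x y)"
    using A by (intro tendsto_sum tendsto_mult_left lim) auto
  then show "0 \<le> (\<Sum>x\<in>A. \<Sum>y\<in>A. c x * c y * L x y)"
    by (rule LIMSEQ_le_const) (use positive_kernel_on_nonneg[OF K] A in blast)
qed

lemma kernel_form_diff:
  fixes K :: "'a \<Rightarrow> 'a \<Rightarrow> real"
  assumes "\<And>x y. \<lbrakk>x \<in> B; y \<in> B\<rbrakk> \<Longrightarrow> K x y = K y x"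
  shows "(\<Sum>x\<in>B. \<Sum>y\<in>B. (c x - d x) * (c y - d y) * K x y)
    = (\<Sum>x\<in>B. \<Sum>y\<in>B. c x * c y * K x y) - 2 * (\<Sum>x\<in>B. \<Sum>y\<in>B. c x * d y * K x y)
      + (\<Sum>x\<in>B. \<Sum>y\<in>B. d x * d y * K x y)"
proof -
  have "(\<Sum>x\<in>B. \<Sum>y\<in>B. d x * c y * K x y) = (\<Sum>x\<in>B. \<Sum>y\<in>B. c x * d y * K x y)"
    by (subst sum.swap) (intro sum.cong refl, simp add: assms mult_ac)
  then show ?thesis
    by (simp add: algebra_simps sum.distrib sum_subtractf)
qed

text \<open>This is \<open>0 \<le> \<parallel>u - v\<parallel>\<^sup>2\<close> for the formal combinations \<open>u = \<Sum>x\<in>A. c x * \<xi> x\<close> and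
  \<open>v = \<Sum>x\<in>B. d x * \<xi> x\<close>. Both are padded by zeros to combinations over \<open>A \<union> B\<close>, where
  positivity of the kernel applies to their difference.\<close>

lemma positive_kernel_on_nonneg_diff:
  fixes c d :: "'a \<Rightarrow> real"
  assumes K: "positive_kernel_on S K" and A: "finite A" "A \<subseteq> S" and B: "finite B" "B \<subseteq> S"
  shows "0 \<le> (\<Sum>x\<in>A. \<Sum>y\<in>A. c x * c y * K x y) - 2 * (\<Sum>x\<in>A. \<Sum>y\<in>B. c x * d y * K x y)
    + (\<Sum>x\<in>B. \<Sum>y\<in>B. d x * d y * K x y)"
proof -
  define c' where "c' x = (if x \<in> A then c x else 0)" for x
  define d' where "d' x = (if x \<in> B then d x else 0)" for x
  have c': "(\<Sum>x\<in>A \<union> B. c' x * h x) = (\<Sum>x\<in>A. c x * h x)" for h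
    using A B by (intro sum.mono_neutral_cong_right) (auto simp: c'_def)
  have d': "(\<Sum>x\<in>A \<union> B. d' x * h x) = (\<Sum>x\<in>B. d x * h x)" for h
    using A B by (intro sum.mono_neutral_cong_right) (auto simp: d'_def)
  have form: "(\<Sum>x\<in>C. \<Sum>y\<in>D. p x * q y * K x y) = (\<Sum>x\<in>C. p x * (\<Sum>y\<in>D. q y * K x y))"
    for C D and p q :: "'a \<Rightarrow> real"
    by (simp only: sum_distrib_left mult.assoc)
  have "0 \<le> (\<Sum>x\<in>A \<union> B. \<Sum>y\<in>A \<union> B. (c' x - d' x) * (c' y - d' y) * K x y)"
    by (rule positive_kernel_on_nonneg[OF K]) (use A B in auto)
  also have "\<dots> = (\<Sum>x\<in>A \<union> B. \<Sum>y\<in>A \<union> B. c' x * c' y * K x y)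
      - 2 * (\<Sum>x\<in>A \<union> B. \<Sum>y\<in>A \<union> B. c' x * d' y * K x y)
      + (\<Sum>x\<in>A \<union> B. \<Sum>y\<in>A \<union> B. d' x * d' y * K x y)"
    by (rule kernel_form_diff) (use A B positive_kernel_on_sym[OF K] in blast)
  finally show ?thesis unfolding form c' d' .
qed

lemma positive_kernel_on_move_point:
  fixes c :: "'a \<Rightarrow> real"
  assumes K: "positive_kernel_on S K" and A: "finite A" "A \<subseteq> S" and b: "b \<in> S"
  shows "0 \<le> (\<Sum>x\<in>A. \<Sum>y\<in>A. c x * c y * K x y) - 2 * s * (\<Sum>x\<in>A. c x * K x b) + s\<^sup>2 * K b b"
  using positive_kernel_on_nonneg_diff[OF K A, of "{b}" c "\<lambda>_. s"] b
  by (simp add: sum_distrib_left mult_ac power2_eq_square)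

text \<open>If \<open>K\<close> is the Gram kernel of \<open>\<xi>\<close>, this is the Gram kernel of \<open>\<xi> - \<xi> b\<close>. It has the same squared
  distance as \<open>K\<close>, but it is determined by that squared distance alone, so that centred kernels can be
  summed as soon as the squared distances can.\<close>

lemma positive_kernel_on_centre:
  assumes K: "positive_kernel_on S K" and b: "b \<in> S"
  shows "positive_kernel_on S (\<lambda>x y. K x y - K x b - K b y + K b b)"
proof (rule positive_kernel_onI)
  fix x y assume "x \<in> S" "y \<in> S"
  then show "K x y - K x b - K b y + K b b = K y x - K y b - K b x + K b b"
    using positive_kernel_on_sym[OF K, of x y] positive_kernel_on_sym[OF K, of x b]
      positive_kernel_on_sym[OF K, of y b] b by simp
next
  fix A and c :: "'a \<Rightarrow> real" assume A: "finite A" "A \<subseteq> S"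
  let ?s = "\<Sum>x\<in>A. c x"
  have l: "?s * (\<Sum>x\<in>A. c x * K x b) = (\<Sum>x\<in>A. \<Sum>y\<in>A. c x * c y * K x b)"
    by (subst mult.commute) (simp only: sum_product, simp add: mult_ac)
  have r: "?s * (\<Sum>x\<in>A. c x * K x b) = (\<Sum>x\<in>A. \<Sum>y\<in>A. c x * c y * K b y)"
    using A positive_kernel_on_sym[OF K b] by (simp only: sum_product) (auto simp: mult_ac intro!: sum.cong)
  have s: "?s\<^sup>2 * K b b = (\<Sum>x\<in>A. \<Sum>y\<in>A. c x * c y * K b b)"
    by (simp only: power2_eq_square sum_product sum_distrib_right[symmetric])
  have "(\<Sum>x\<in>A. \<Sum>y\<in>A. c x * c y * (K x y - K x b - K b y + K b b))
      = (\<Sum>x\<in>A. \<Sum>y\<in>A. c x * c y * K x y) - ?s * (\<Sum>x\<in>A. c x * K x b) - ?s * (\<Sum>x\<in>A. c x * K x b)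
        + ?s\<^sup>2 * K b b"
    by (subst l, subst r, subst s) (simp add: algebra_simps sum.distrib sum_subtractf)
  also have "\<dots> \<ge> 0"
    using positive_kernel_on_move_point[OF K A b, of c ?s] by simp
  finally show "0 \<le> (\<Sum>x\<in>A. \<Sum>y\<in>A. c x * c y * (K x y - K x b - K b y + K b b))" .
qed

text \<open>Nonnegativity of the squared distance of \<open>\<xi> x\<close> and \<open>s * \<xi> y\<close>; varying \<open>s\<close> gives the Cauchy-Schwarz inequality.\<close>

lemma positive_kernel_on_two_points:
  assumes K: "positive_kernel_on S K" and xy: "x \<in> S" "y \<in> S"
  shows "0 \<le> K x x - 2 * s * K x y + s\<^sup>2 * K y y"
  using positive_kernel_on_move_point[OF K, of "{x}" y "\<lambda>_. 1" s] xy by simp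

section \<open>Products of kernels and the Gaussian kernel\<close>

lemma positive_kernel_on_zero_column:
  assumes K: "positive_kernel_on S K" and a: "a \<in> S" "K a a = 0" and x: "x \<in> S"
  shows "K x a = 0"
proof (rule ccontr)
  assume nz: "K x a \<noteq> 0"
  with positive_kernel_on_two_points[OF K x a(1), of "(K x x + 1) / (2 * K x a)"] a(2)
  show False by simp
qed

text \<open>The Gram kernel of the projections of the \<open>\<xi> x\<close> to the orthogonal complement of \<open>\<xi> a\<close>: one step
  of a Cholesky decomposition. Completing the square at the point \<open>a\<close> proves it.\<close>

lemma positive_kernel_on_complement:
  assumes K: "positive_kernel_on S K" and a: "a \<in> S" "K a a > 0"
  shows "positive_kernel_on S (\<lambda>x y. K x y - K x a * K y a / K a a)"
proof (rule positive_kernel_onI)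
  fix x y assume "x \<in> S" "y \<in> S"
  then show "K x y - K x a * K y a / K a a = K y x - K y a * K x a / K a a"
    using positive_kernel_on_sym[OF K, of x y] by simp
next
  fix A and c :: "'a \<Rightarrow> real" assume A: "finite A" "A \<subseteq> S"
  let ?l = "\<Sum>x\<in>A. c x * K x a"
  have "(\<Sum>x\<in>A. \<Sum>y\<in>A. c x * c y * (K x a * K y a / K a a)) = ?l * ?l / K a a"
    by (simp only: sum_product sum_divide_distrib) (simp add: mult_ac)
  then have "(\<Sum>x\<in>A. \<Sum>y\<in>A. c x * c y * (K x y - K x a * K y a / K a a))
      = (\<Sum>x\<in>A. \<Sum>y\<in>A. c x * c y * K x y) - ?l * ?l / K a a"
    by (simp only: right_diff_distrib sum_subtractf)
  also have "\<dots> \<ge> 0"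
    using positive_kernel_on_move_point[OF K A a(1), of c "?l / K a a"] a(2)
    by (simp add: power2_eq_square)
  finally show "0 \<le> (\<Sum>x\<in>A. \<Sum>y\<in>A. c x * c y * (K x y - K x a * K y a / K a a))" .
qed

text \<open>The Schur product theorem. On a finite set, \<open>K\<close> is stripped of one point at a time: it is the sum of
  the rank one kernel \<open>K x a * K y a / K a a\<close>, whose product with \<open>L\<close> is a rescaling of \<open>L\<close>, and a kernel
  that vanishes in the row and column of \<open>a\<close> and is therefore covered by the induction hypothesis.\<close>

lemma positive_kernel_on_schur:
  assumes "positive_kernel_on S K" and L: "positive_kernel_on S L"
  shows "positive_kernel_on S (\<lambda>x y. K x y * L x y)"
proof (rule positive_kernel_onI)
  fix x y assume "x \<in> S" "y \<in> S"
  then show "K x y * L x y = K y x * L y x"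
    using positive_kernel_on_sym[OF assms(1), of x y] positive_kernel_on_sym[OF L, of x y] by simp
next
  fix A and c :: "'a \<Rightarrow> real" assume "finite A" "A \<subseteq> S"
  moreover have "positive_kernel_on A K"
    by (rule positive_kernel_on_subset[OF assms(1)]) fact
  ultimately show "0 \<le> (\<Sum>x\<in>A. \<Sum>y\<in>A. c x * c y * (K x y * L x y))"
  proof (induction A arbitrary: K rule: finite_induct)
    case empty
    show ?case by simp
  next
    case (insert a A)
    let ?B = "insert a A"
    note KB = insert.prems(2)
    \<comment> \<open>Kernels whose column at \<open>a\<close> vanishes are covered by the induction hypothesis.\<close>
    have step: "0 \<le> (\<Sum>x\<in>?B. \<Sum>y\<in>?B. c x * c y * (M x y * L x y))"
      if M: "positive_kernel_on ?B M" and col: "\<And>x. x \<in> ?B \<Longrightarrow> M x a = 0" for M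
    proof -
      have row: "M a x = 0" if "x \<in> ?B" for x
        using col that positive_kernel_on_sym[OF M, of a x] by simp
      have "(\<Sum>x\<in>?B. \<Sum>y\<in>?B. c x * c y * (M x y * L x y)) = (\<Sum>x\<in>A. \<Sum>y\<in>A. c x * c y * (M x y * L x y))"
        using insert.hyps by (simp add: col row)
      also have "0 \<le> \<dots>"
        using insert.prems(1) by (intro insert.IH positive_kernel_on_subset[OF M]) auto
      finally show ?thesis .
    qed
    have aB: "a \<in> ?B" by simp
    have "0 \<le> (\<Sum>x\<in>{a}. \<Sum>y\<in>{a}. 1 * 1 * K x y)"
      by (rule positive_kernel_on_nonneg[OF KB]) auto
    then have "K a a \<ge> 0" by simp
    then consider "K a a = 0" | "K a a > 0" by linarith
    then show ?case
    proof cases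
      case 1
      show ?thesis
        by (intro step[OF KB] positive_kernel_on_zero_column[OF KB aB 1])
    next
      case 2
      let ?M = "\<lambda>x y. K x y - K x a * K y a / K a a"
      have "0 \<le> (\<Sum>x\<in>?B. \<Sum>y\<in>?B. c x * c y * (?M x y * L x y))"
        by (rule step[OF positive_kernel_on_complement[OF KB aB 2]]) (use 2 in simp)
      moreover have "0 \<le> (\<Sum>x\<in>?B. \<Sum>y\<in>?B. (c x * K x a) * (c y * K y a) * L x y) / K a a"
        by (rule divide_nonneg_pos[OF positive_kernel_on_nonneg 2]) (use L insert.prems(1) insert.hyps(1) in auto)
      moreover have "(\<Sum>x\<in>?B. \<Sum>y\<in>?B. (c x * K x a) * (c y * K y a) * L x y) / K a a
          = (\<Sum>x\<in>?B. \<Sum>y\<in>?B. c x * c y * ((K x a * K y a / K a a) * L x y))"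
        by (simp only: sum_divide_distrib) (simp add: mult_ac)
      moreover have "(\<Sum>x\<in>?B. \<Sum>y\<in>?B. c x * c y * (K x y * L x y))
          = (\<Sum>x\<in>?B. \<Sum>y\<in>?B. c x * c y * (?M x y * L x y))
          + (\<Sum>x\<in>?B. \<Sum>y\<in>?B. c x * c y * ((K x a * K y a / K a a) * L x y))"
        by (simp only: sum.distrib[symmetric] distrib_left[symmetric] distrib_right[symmetric] diff_add_cancel)
      ultimately show ?thesis by linarith
    qed
  qed
qed

text \<open>By the Schur product theorem the partial sums of the exponential series are positive definite.\<close>

lemma positive_kernel_on_exp:
  assumes "positive_kernel_on S K"
  shows "positive_kernel_on S (\<lambda>x y. exp (K x y))"
proof (rule positive_kernel_on_limit)
  have pow: "positive_kernel_on S (\<lambda>x y. K x y ^ k)" for k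
    by (induction k) (simp_all add: positive_kernel_on_const positive_kernel_on_schur[OF assms])
  show "positive_kernel_on S (\<lambda>x y. \<Sum>k<n. inverse (fact k) * K x y ^ k)" for n
    by (intro positive_kernel_on_sum positive_kernel_on_schur pow positive_kernel_on_const) simp
  show "(\<lambda>n. \<Sum>k<n. inverse (fact k) * K x y ^ k) \<longlonglongrightarrow> exp (K x y)" for x y
    using exp_converges[of "K x y"] by (simp add: sums_def)
qed

lemma (in real_inner_space) positive_kernel_on_inner:
  assumes F: "\<And>x. x \<in> S \<Longrightarrow> F x \<in> vectors H"
  shows "positive_kernel_on S (\<lambda>x y. vinner H (F x) (F y))"
proof (rule positive_kernel_onI)
  fix A and c :: "'a \<Rightarrow> real" assume A: "finite A" "A \<subseteq> S"
  from A have "\<exists>v\<in>vectors H. \<forall>w\<in>vectors H. vinner H v w = (\<Sum>x\<in>A. c x * vinner H (F x) w)"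
  proof (induction A rule: finite_induct)
    case empty
    then show ?case using zero_closed inner_zero_left by auto
  next
    case (insert a A)
    then obtain v where "v \<in> vectors H" "\<And>w. w \<in> vectors H \<Longrightarrow> vinner H v w = (\<Sum>x\<in>A. c x * vinner H (F x) w)"
      by auto
    with insert show ?case
      by (intro bexI[of _ "vadd H (vscale H (c a) (F a)) v"])
        (simp_all add: F add_closed scale_closed inner_add_left inner_scale_left)
  qed
  then obtain v where v: "v \<in> vectors H"
    "\<And>w. w \<in> vectors H \<Longrightarrow> vinner H v w = (\<Sum>x\<in>A. c x * vinner H (F x) w)"
    by blast
  have "vinner H v v = (\<Sum>x\<in>A. c x * vinner H v (F x))"
    unfolding v(2)[OF v(1)]
    by (intro sum.cong refl arg_cong2[where f = "(*)"] inner_commute v(1)) (use A F in auto)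
  also have "\<dots> = (\<Sum>x\<in>A. \<Sum>y\<in>A. c x * c y * vinner H (F x) (F y))"
  proof (rule sum.cong[OF refl])
    fix x assume "x \<in> A"
    then have "F x \<in> vectors H" using A F by blast
    then have "vinner H v (F x) = (\<Sum>y\<in>A. c y * vinner H (F y) (F x))"
      by (rule v(2))
    also have "\<dots> = (\<Sum>y\<in>A. c y * vinner H (F x) (F y))"
      by (intro sum.cong refl arg_cong2[where f = "(*)"] inner_commute) (use A F \<open>x \<in> A\<close> in auto)
    finally show "c x * vinner H v (F x) = (\<Sum>y\<in>A. c x * c y * vinner H (F x) (F y))"
      by (simp add: sum_distrib_left mult.assoc)
  qed
  finally show "0 \<le> (\<Sum>x\<in>A. \<Sum>y\<in>A. c x * c y * vinner H (F x) (F y))"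
    using inner_nonneg[OF v(1)] by simp
qed (simp add: F inner_commute)

text \<open>Since \<open>\<parallel>u - v\<parallel>\<^sup>2 = \<parallel>u\<parallel>\<^sup>2 - 2 \<langle>u, v\<rangle> + \<parallel>v\<parallel>\<^sup>2\<close>, the Gaussian is the exponential of a multiple of the Gram
  kernel, rescaled by a function of \<open>x\<close> times the same function of \<open>y\<close>. The Gaussian is what turns an
  unbounded distance into a bounded kernel that is near \<open>1\<close> at small and near \<open>0\<close> at large distances.\<close>

lemma (in real_inner_space) positive_kernel_on_gaussian:
  assumes F: "\<And>x. x \<in> S \<Longrightarrow> F x \<in> vectors H" and t: "0 \<le> t"
  shows "positive_kernel_on S (\<lambda>x y. exp (- t * (vdist H (F x) (F y))\<^sup>2))"
proof -
  let ?g = "\<lambda>x. exp (- t * vinner H (F x) (F x))"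
  have "positive_kernel_on S (\<lambda>x y. ?g x * ?g y * exp (2 * t * vinner H (F x) (F y)))"
    by (intro positive_kernel_on_scale[where S = S] positive_kernel_on_exp positive_kernel_on_schur
        positive_kernel_on_const positive_kernel_on_inner F) (use t in auto)
  then show ?thesis
  proof (rule positive_kernel_on_cong)
    fix x y assume "x \<in> S" "y \<in> S"
    then have "- t * vinner H (F x) (F x) + - t * vinner H (F y) (F y) + 2 * t * vinner H (F x) (F y)
        = - t * (vdist H (F x) (F y))\<^sup>2"
      by (simp add: vdist_square F algebra_simps)
    then show "?g x * ?g y * exp (2 * t * vinner H (F x) (F y)) = exp (- t * (vdist H (F x) (F y))\<^sup>2)"
      by (simp only: mult_exp_exp)
  qed
qed

text \<open>The orthogonal direct sum of the kernels \<open>k U\<close>: a quadratic form that is block diagonal with respect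
  to the fibres of \<open>J\<close> is the sum of the forms of its blocks.\<close>

lemma positive_kernel_on_blocks:
  fixes J :: "'b \<Rightarrow> 'c"
  assumes k: "\<And>U. positive_kernel_on {x \<in> S. J x = U} (k U)"
  shows "positive_kernel_on S (\<lambda>x y. if J x = J y then k (J x) x y else 0)"
proof (rule positive_kernel_onI)
  fix x y assume "x \<in> S" "y \<in> S"
  then show "(if J x = J y then k (J x) x y else 0) = (if J y = J x then k (J y) y x else 0)"
    using positive_kernel_on_sym[OF k, of x "J x" y] by auto
next
  fix A and c :: "'b \<Rightarrow> real" assume A: "finite A" "A \<subseteq> S"
  have "(\<Sum>x\<in>A. \<Sum>y\<in>A. c x * c y * (if J x = J y then k (J x) x y else 0))
     = (\<Sum>x\<in>A. \<Sum>y\<in>{y \<in> A. J y = J x}. c x * c y * k (J x) x y)"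
    using A by (intro sum.cong refl sum.mono_neutral_cong_right) auto
  also have "\<dots> = (\<Sum>U\<in>J ` A. \<Sum>x\<in>{x \<in> A. J x = U}. \<Sum>y\<in>{y \<in> A. J y = J x}. c x * c y * k (J x) x y)"
    by (rule sum.image_gen[OF A(1)])
  also have "\<dots> = (\<Sum>U\<in>J ` A. \<Sum>x\<in>{x \<in> A. J x = U}. \<Sum>y\<in>{y \<in> A. J y = U}. c x * c y * k U x y)"
    by (intro sum.cong refl) auto
  also have "\<dots> \<ge> 0"
    by (intro sum_nonneg positive_kernel_on_nonneg[OF k]) (use A in auto)
  finally show "0 \<le> (\<Sum>x\<in>A. \<Sum>y\<in>A. c x * c y * (if J x = J y then k (J x) x y else 0))" .
qed

section \<open>Inner products from the parallelogram law\<close>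

text \<open>The defect \<open>e t = h t - t * h 1\<close> is additive and vanishes on the integers, hence is periodic with
  period \<open>1\<close>. Being bounded on \<open>[0, 1]\<close>, it is bounded everywhere, and a bounded additive function
  is zero.\<close>

lemma additive_quadratic_bound_imp_homogeneous:
  fixes h :: "real \<Rightarrow> real"
  assumes add: "\<And>s t. h (s + t) = h s + h t" and bound: "\<And>t. \<bar>h t\<bar> \<le> a * t\<^sup>2 + b"
  shows "h t = t * h 1"
proof -
  define e where "e t = h t - t * h 1" for t
  have e_add: "e (s + t) = e s + e t" for s t
    by (simp add: e_def add algebra_simps)
  have e0: "e 0 = 0" using e_add[of 0 0] by simp
  have e1: "e 1 = 0" by (simp add: e_def)
  have e_nat: "e (real n * t) = real n * e t" for n t
    by (induction n) (simp_all add: e0 e_add algebra_simps)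
  have e_neg: "e (- t) = - e t" for t
    using e_add[of t "- t"] e0 by simp
  have e_int: "e (of_int k) = 0" for k
    using e_nat[of "nat \<bar>k\<bar>" 1] e1 e_neg[of "of_int k"] by (cases "k \<ge> 0") auto
  define M where "M = \<bar>a\<bar> + \<bar>b\<bar> + \<bar>h 1\<bar>"
  have M: "\<bar>e t\<bar> \<le> M" for t
  proof -
    have "e t = e (of_int \<lfloor>t\<rfloor> + frac t)" by (simp add: frac_def)
    also have "\<dots> = e (frac t)" by (simp only: e_add e_int)
    finally have "\<bar>e t\<bar> \<le> \<bar>h (frac t)\<bar> + \<bar>frac t * h 1\<bar>" unfolding e_def by linarith
    also have "\<bar>h (frac t)\<bar> \<le> a * (frac t)\<^sup>2 + b" by (rule bound)
    also have "a * (frac t)\<^sup>2 \<le> \<bar>a\<bar> * 1"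
      using frac_ge_0[of t] frac_lt_1[of t] by (intro mult_mono power_le_one) auto
    also have "\<bar>frac t * h 1\<bar> \<le> 1 * \<bar>h 1\<bar>"
      unfolding abs_mult using frac_ge_0[of t] frac_lt_1[of t] by (intro mult_mono) auto
    finally show ?thesis by (simp add: M_def)
  qed
  have "e t = 0"
  proof (rule ccontr)
    assume nz: "e t \<noteq> 0"
    obtain n where "M / \<bar>e t\<bar> < real n" using reals_Archimedean2 by blast
    then have "M < real n * \<bar>e t\<bar>"
      using nz by (simp add: pos_divide_less_eq)
    then have "M < \<bar>e (real n * t)\<bar>"
      by (simp add: e_nat abs_mult)
    with M show False by (meson not_less)
  qed
  then show ?thesis by (simp add: e_def)
qed

text \<open>The theorem of Jordan and von Neumann: a quadratic functional that satisfies the parallelogram law is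
  given by an inner product, found by polarisation. Additivity follows from four instances of the law,
  and homogeneity from additivity in one variable together with
  \<open>\<bar>B (t f) g\<bar> \<le> N (t f) + N g = t\<^sup>2 * N f + N g\<close>.\<close>

lemma real_inner_space_parallelogram:
  fixes V :: "('a \<Rightarrow> real) set" and N :: "('a \<Rightarrow> real) \<Rightarrow> real"
  assumes zero: "0 \<in> V" and add: "\<And>f g. \<lbrakk>f \<in> V; g \<in> V\<rbrakk> \<Longrightarrow> f + g \<in> V"
    and scale: "\<And>a f. f \<in> V \<Longrightarrow> (\<lambda>x. a * f x) \<in> V"
    and N_scale: "\<And>a f. f \<in> V \<Longrightarrow> N (\<lambda>x. a * f x) = a\<^sup>2 * N f"
    and N_nonneg: "\<And>f. f \<in> V \<Longrightarrow> 0 \<le> N f"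
    and N_zero: "\<And>f. \<lbrakk>f \<in> V; N f = 0\<rbrakk> \<Longrightarrow> f = 0"
    and par: "\<And>f g. \<lbrakk>f \<in> V; g \<in> V\<rbrakk> \<Longrightarrow> N (f + g) + N (f - g) = 2 * N f + 2 * N g"
  defines "H \<equiv> \<lparr>vectors = V, vzero = 0, vadd = (+), vscale = (\<lambda>a f x. a * f x),
      vinner = (\<lambda>f g. (N (f + g) - N (f - g)) / 4)\<rparr>"
  shows "real_inner_space H" and "\<And>f g. \<lbrakk>f \<in> V; g \<in> V\<rbrakk> \<Longrightarrow> vdist H f g = sqrt (N (f - g))"
proof -
  have minus: "- f \<in> V" "N (- f) = N f" if "f \<in> V" for f
    using scale[OF that, of "-1"] N_scale[OF that, of "-1"] by (simp_all add: fun_Compl_def)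
  have diff: "f - g \<in> V" if "f \<in> V" "g \<in> V" for f g
    using add[OF that(1) minus(1)[OF that(2)]] by simp
  have N0: "N 0 = 0" using N_scale[OF zero, of 0] by (simp add: zero_fun_def)
  define B where "B f g = (N (f + g) - N (f - g)) / 4" for f g
  have B_self: "B f f = N f" if "f \<in> V" for f
    using par[OF that that] N0 by (simp add: B_def)
  have B_commute: "B f g = B g f" if "f \<in> V" "g \<in> V" for f g
    using minus(2)[OF diff[OF that]] by (simp add: B_def add.commute)
  have B_add: "B (f + g) h = B f h + B g h" if [simp]: "f \<in> V" "g \<in> V" "h \<in> V" for f g h
  proof -
    have assoc: "f + h + g = f + g + h" "g + h + f = f + g + h" "f - h + g = f + g - h" "g - h + f = f + g - h"
      by simp_all
    have "N (f + g + h) + N (f + h - g) = 2 * N (f + h) + 2 * N g"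
      "N (f + g + h) + N (g + h - f) = 2 * N (g + h) + 2 * N f"
      "N (f + g - h) + N (f - h - g) = 2 * N (f - h) + 2 * N g"
      "N (f + g - h) + N (g - h - f) = 2 * N (g - h) + 2 * N f"
      using par[of "f + h" g] par[of "g + h" f] par[of "f - h" g] par[of "g - h" f]
      unfolding assoc by (simp_all only: that add diff)
    moreover have "N (f + h - g) = N (g - h - f)" "N (g + h - f) = N (f - h - g)"
      using minus(2)[of "f + h - g"] minus(2)[of "g + h - f"] by (simp_all add: add diff algebra_simps)
    ultimately show ?thesis unfolding B_def by argo
  qed
  have B_scale: "B (\<lambda>x. a * f x) g = a * B f g" if f: "f \<in> V" and g: "g \<in> V" for a f g
  proof -
    define h where "h t = B (\<lambda>x. t * f x) g" for t
    have "\<bar>h t\<bar> \<le> N f * t\<^sup>2 + N g" for t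
    proof -
      let ?f = "\<lambda>x. t * f x"
      have "N (?f + g) \<ge> 0" "N (?f - g) \<ge> 0" "N ?f = t\<^sup>2 * N f" "N g \<ge> 0" "t\<^sup>2 * N f \<ge> 0"
        using f g by (simp_all add: N_nonneg N_scale add diff scale)
      moreover have "N (?f + g) + N (?f - g) = 2 * N ?f + 2 * N g"
        using f g by (simp add: par scale)
      ultimately show ?thesis unfolding h_def B_def by (simp add: abs_le_iff field_simps)
    qed
    moreover have "h (s + t) = h s + h t" for s t
    proof -
      have "(\<lambda>x. (s + t) * f x) = (\<lambda>x. s * f x) + (\<lambda>x. t * f x)"
        by (simp add: fun_eq_iff algebra_simps)
      then show ?thesis unfolding h_def using B_add[OF scale[OF f] scale[OF f] g] by simp
    qed
    ultimately have "h a = a * h 1"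
      by (intro additive_quadratic_bound_imp_homogeneous)
    then show ?thesis by (simp add: h_def)
  qed
  have H: "vectors H = V" "vzero H = 0" "vadd H = (+)" "vscale H = (\<lambda>a f x. a * f x)" "vinner H = B"
    by (simp_all add: H_def B_def fun_eq_iff)
  show "real_inner_space H"
  proof (unfold_locales, unfold H)
    show "\<exists>g\<in>V. f + g = 0" if "f \<in> V" for f
      using minus(1)[OF that] by (intro bexI[of _ "- f"]) auto
    show "f = 0" if "f \<in> V" "B f f = 0" for f using that by (simp add: B_self N_zero)
    show "B f g = B g f" if "f \<in> V" "g \<in> V" for f g by (rule B_commute[OF that])
  qed (auto simp: zero add scale B_add B_scale B_self N_nonneg fun_eq_iff distrib_left distrib_right)
  have "vdiff H f g = f - g" for f g
    by (simp add: vdiff_def H fun_eq_iff)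
  then show "vdist H f g = sqrt (N (f - g))" if "f \<in> V" "g \<in> V" for f g
    using that by (simp add: vdist_def H B_self diff)
qed

section \<open>The Hilbert space of a kernel\<close>

text \<open>For \<open>v = \<Sum>x\<in>A. c x * K x\<close> in the Hilbert space of \<open>K\<close> this is \<open>2 \<langle>f, v\<rangle> - \<parallel>v\<parallel>\<^sup>2 = \<parallel>f\<parallel>\<^sup>2 - \<parallel>f - v\<parallel>\<^sup>2\<close>.
  Its supremum over all \<open>v\<close> is \<open>\<parallel>f\<parallel>\<^sup>2\<close>, so that the space and its norm can be described without forming
  a completion.\<close>

definition kernel_test :: "('a \<Rightarrow> 'a \<Rightarrow> real) \<Rightarrow> ('a \<Rightarrow> real) \<Rightarrow> 'a set \<Rightarrow> ('a \<Rightarrow> real) \<Rightarrow> real" where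
  "kernel_test K f A c = 2 * (\<Sum>x\<in>A. c x * f x) - (\<Sum>x\<in>A. \<Sum>y\<in>A. c x * c y * K x y)"

definition kernel_space :: "('a \<Rightarrow> 'a \<Rightarrow> real) \<Rightarrow> ('a \<Rightarrow> real) set" where
  "kernel_space K = {f. \<exists>b. \<forall>A c. finite A \<longrightarrow> kernel_test K f A c \<le> b}"

definition kernel_sqnorm :: "('a \<Rightarrow> 'a \<Rightarrow> real) \<Rightarrow> ('a \<Rightarrow> real) \<Rightarrow> real" where
  "kernel_sqnorm K f = Sup {kernel_test K f A c | A c. finite A}"

lemma kernel_test_le_sqnorm:
  assumes "f \<in> kernel_space K" "finite A"
  shows "kernel_test K f A c \<le> kernel_sqnorm K f"
  unfolding kernel_sqnorm_def
  by (rule cSup_upper) (use assms in \<open>auto simp: kernel_space_def bdd_above_def\<close>)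

lemma kernel_sqnorm_leI:
  assumes "\<And>A c. finite A \<Longrightarrow> kernel_test K f A c \<le> b"
  shows "f \<in> kernel_space K" and "kernel_sqnorm K f \<le> b"
proof -
  show "f \<in> kernel_space K" using assms by (auto simp: kernel_space_def)
  show "kernel_sqnorm K f \<le> b"
    unfolding kernel_sqnorm_def by (rule cSup_least) (use assms in auto)
qed

lemma kernel_sqnorm_nonneg: "f \<in> kernel_space K \<Longrightarrow> 0 \<le> kernel_sqnorm K f"
  using kernel_test_le_sqnorm[of f K "{}"] by (simp add: kernel_test_def)

lemma kernel_test_pad:
  assumes "finite A" "finite B"
  shows "kernel_test K f A c = kernel_test K f (A \<union> B) (\<lambda>x. if x \<in> A then c x else 0)"
proof -
  have pad: "(\<Sum>x\<in>A \<union> B. (if x \<in> A then c x else 0) * h x) = (\<Sum>x\<in>A. c x * h x)" for h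
    using assms by (intro sum.mono_neutral_cong_right) auto
  show ?thesis
    unfolding kernel_test_def mult.assoc sum_distrib_left[symmetric] pad ..
qed

text \<open>On a common finite set, the combinations \<open>c\<close> for \<open>f + g\<close> and \<open>d\<close> for \<open>f - g\<close> are traded for
  \<open>(c + d) / 2\<close> for \<open>f\<close> and \<open>(c - d) / 2\<close> for \<open>g\<close>; both the linear and the quadratic parts agree. Taking
  suprema gives one half of the parallelogram law, and the other half follows from it by applying it to
  \<open>f + g\<close> and \<open>f - g\<close>.\<close>

lemma kernel_test_parallelogram:
  assumes "finite A" "finite B" and f: "f \<in> kernel_space K" and g: "g \<in> kernel_space K"
  shows "kernel_test K (f + g) A c + kernel_test K (f - g) B d
    \<le> 2 * kernel_sqnorm K f + 2 * kernel_sqnorm K g"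
proof -
  define c' where "c' x = (if x \<in> A then c x else 0)" for x
  define d' where "d' x = (if x \<in> B then d x else 0)" for x
  let ?C = "A \<union> B"
  have "kernel_test K (f + g) A c + kernel_test K (f - g) B d
      = kernel_test K (f + g) ?C c' + kernel_test K (f - g) ?C d'"
    using kernel_test_pad[of A B K "f + g" c] kernel_test_pad[of B A K "f - g" d] assms
    by (simp add: c'_def[abs_def] d'_def[abs_def] Un_commute)
  also have "\<dots> = 2 * kernel_test K f ?C (\<lambda>x. (c' x + d' x) / 2) + 2 * kernel_test K g ?C (\<lambda>x. (c' x - d' x) / 2)"
  proof -
    have lin: "(\<Sum>x\<in>?C. c' x * (f + g) x) + (\<Sum>x\<in>?C. d' x * (f - g) x)
        = 2 * (\<Sum>x\<in>?C. (c' x + d' x) / 2 * f x) + 2 * (\<Sum>x\<in>?C. (c' x - d' x) / 2 * g x)"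
      unfolding sum_distrib_left sum.distrib[symmetric] by (intro sum.cong refl) (simp add: field_simps)
    have quad: "(\<Sum>x\<in>?C. \<Sum>y\<in>?C. c' x * c' y * K x y) + (\<Sum>x\<in>?C. \<Sum>y\<in>?C. d' x * d' y * K x y)
        = 2 * (\<Sum>x\<in>?C. \<Sum>y\<in>?C. (c' x + d' x) / 2 * ((c' y + d' y) / 2) * K x y)
          + 2 * (\<Sum>x\<in>?C. \<Sum>y\<in>?C. (c' x - d' x) / 2 * ((c' y - d' y) / 2) * K x y)"
      unfolding sum_distrib_left sum.distrib[symmetric] by (intro sum.cong refl) (simp add: field_simps)
    show ?thesis using lin quad unfolding kernel_test_def by argo
  qed
  also have "\<dots> \<le> 2 * kernel_sqnorm K f + 2 * kernel_sqnorm K g"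
    using kernel_test_le_sqnorm[OF f, of ?C] kernel_test_le_sqnorm[OF g, of ?C] assms
    by (intro add_mono mult_left_mono) auto
  finally show ?thesis .
qed

lemma kernel_space_add_diff:
  assumes f: "f \<in> kernel_space K" and g: "g \<in> kernel_space K"
  shows "f + g \<in> kernel_space K" "f - g \<in> kernel_space K"
    and "kernel_sqnorm K (f + g) + kernel_sqnorm K (f - g) \<le> 2 * kernel_sqnorm K f + 2 * kernel_sqnorm K g"
proof -
  let ?b = "2 * kernel_sqnorm K f + 2 * kernel_sqnorm K g"
  note par = kernel_test_parallelogram[OF _ _ f g]
  show "f + g \<in> kernel_space K"
    using par[of _ "{}"] by (intro kernel_sqnorm_leI(1)[of K _ ?b]) (simp add: kernel_test_def)
  show diff: "f - g \<in> kernel_space K"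
    using par[of "{}"] by (intro kernel_sqnorm_leI(1)[of K _ ?b]) (simp add: kernel_test_def)
  have "kernel_test K (f + g) A c \<le> ?b - kernel_sqnorm K (f - g)" if "finite A" for A c
  proof -
    have "kernel_sqnorm K (f - g) \<le> ?b - kernel_test K (f + g) A c"
      by (rule kernel_sqnorm_leI(2)) (use par[OF that] in \<open>simp add: algebra_simps\<close>)
    then show ?thesis by simp
  qed
  then have "kernel_sqnorm K (f + g) \<le> ?b - kernel_sqnorm K (f - g)"
    by (rule kernel_sqnorm_leI(2))
  then show "kernel_sqnorm K (f + g) + kernel_sqnorm K (f - g) \<le> ?b" by simp
qed

context
  fixes K :: "'a \<Rightarrow> 'a \<Rightarrow> real"
  assumes K: "positive_kernel_on UNIV K"
begin

lemma kernel_space_zero: "0 \<in> kernel_space K" "kernel_sqnorm K 0 = 0"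
proof -
  have "kernel_test K 0 A c \<le> 0" if "finite A" for A c
    using positive_kernel_on_nonneg[OF K that] by (simp add: kernel_test_def)
  from kernel_sqnorm_leI[OF this] show "0 \<in> kernel_space K" "kernel_sqnorm K 0 = 0"
    using kernel_sqnorm_nonneg[of 0 K] by auto
qed

lemma kernel_space_scale:
  assumes f: "f \<in> kernel_space K"
  shows "(\<lambda>x. a * f x) \<in> kernel_space K" and "kernel_sqnorm K (\<lambda>x. a * f x) = a\<^sup>2 * kernel_sqnorm K f"
proof -
  have test: "kernel_test K (\<lambda>x. a * f x) A c \<le> a\<^sup>2 * kernel_sqnorm K f"
    if f: "f \<in> kernel_space K" and "finite A" "a \<noteq> 0" for f A c a
  proof -
    have lin: "(\<Sum>x\<in>A. c x * (a * f x)) = a\<^sup>2 * (\<Sum>x\<in>A. c x / a * f x)"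
      unfolding sum_distrib_left using that by (intro sum.cong) (auto simp: power2_eq_square)
    have quad: "(\<Sum>x\<in>A. \<Sum>y\<in>A. c x * c y * K x y) = a\<^sup>2 * (\<Sum>x\<in>A. \<Sum>y\<in>A. c x / a * (c y / a) * K x y)"
      unfolding sum_distrib_left using that by (intro sum.cong) (auto simp: power2_eq_square)
    have "kernel_test K (\<lambda>x. a * f x) A c = a\<^sup>2 * kernel_test K f A (\<lambda>x. c x / a)"
      unfolding kernel_test_def lin quad by (simp add: algebra_simps)
    also have "\<dots> \<le> a\<^sup>2 * kernel_sqnorm K f"
      by (intro mult_left_mono kernel_test_le_sqnorm f that) auto
    finally show ?thesis .
  qed
  have le: "(\<lambda>x. a * f x) \<in> kernel_space K" "kernel_sqnorm K (\<lambda>x. a * f x) \<le> a\<^sup>2 * kernel_sqnorm K f"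
    if "f \<in> kernel_space K" "a \<noteq> 0" for f a
    using kernel_sqnorm_leI[OF test[OF that(1) _ that(2)]] by auto
  show "(\<lambda>x. a * f x) \<in> kernel_space K"
    using le(1)[OF f] kernel_space_zero by (cases "a = 0") (auto simp: zero_fun_def)
  show "kernel_sqnorm K (\<lambda>x. a * f x) = a\<^sup>2 * kernel_sqnorm K f"
  proof (cases "a = 0")
    case True
    then show ?thesis using kernel_space_zero by (simp add: zero_fun_def)
  next
    case False
    have "kernel_sqnorm K f = kernel_sqnorm K (\<lambda>x. inverse a * (a * f x))"
      using False by (simp add: mult.assoc[symmetric])
    also have "\<dots> \<le> (inverse a)\<^sup>2 * kernel_sqnorm K (\<lambda>x. a * f x)"
      by (rule le(2)) (use le(1)[OF f False] False in auto)
    finally have "a\<^sup>2 * kernel_sqnorm K f \<le> kernel_sqnorm K (\<lambda>x. a * f x)"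
      using False by (simp add: field_simps)
    with le(2)[OF f False] show ?thesis by simp
  qed
qed

lemma kernel_sqnorm_parallelogram:
  assumes f: "f \<in> kernel_space K" and g: "g \<in> kernel_space K"
  shows "kernel_sqnorm K (f + g) + kernel_sqnorm K (f - g) = 2 * kernel_sqnorm K f + 2 * kernel_sqnorm K g"
proof (rule antisym)
  show "kernel_sqnorm K (f + g) + kernel_sqnorm K (f - g) \<le> 2 * kernel_sqnorm K f + 2 * kernel_sqnorm K g"
    by (rule kernel_space_add_diff(3)[OF f g])
  note fg = kernel_space_add_diff(1,2)[OF f g]
  have "(f + g) + (f - g) = (\<lambda>x. 2 * f x)" "(f + g) - (f - g) = (\<lambda>x. 2 * g x)"
    by (simp_all add: fun_eq_iff)
  then show "2 * kernel_sqnorm K f + 2 * kernel_sqnorm K g \<le> kernel_sqnorm K (f + g) + kernel_sqnorm K (f - g)"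
    using kernel_space_add_diff(3)[OF fg] kernel_space_scale(2)[OF f, of 2] kernel_space_scale(2)[OF g, of 2]
    by simp
qed

text \<open>Testing \<open>f\<close> at the single point \<open>x\<close>. The optimal coefficient is \<open>f x / K x x\<close>; adding \<open>1\<close> to the
  denominator avoids a case distinction for \<open>K x x = 0\<close>. So the norm controls point evaluations: it is
  definite, and Cauchy sequences converge pointwise.\<close>

lemma kernel_space_pointwise_bound:
  assumes f: "f \<in> kernel_space K"
  shows "(f x)\<^sup>2 \<le> (K x x + 1) * kernel_sqnorm K f"
proof -
  have pos: "0 \<le> K x x"
    using positive_kernel_on_nonneg[OF K, of "{x}" "\<lambda>_. 1"] by simp
  let ?t = "f x / (K x x + 1)"
  have "(f x)\<^sup>2 / (K x x + 1) \<le> 2 * (?t * f x) - ?t * ?t * K x x"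
    using pos by (simp add: divide_simps) (simp add: algebra_simps power2_eq_square)
  also have "\<dots> = kernel_test K f {x} (\<lambda>_. ?t)" by (simp add: kernel_test_def)
  also have "\<dots> \<le> kernel_sqnorm K f" by (rule kernel_test_le_sqnorm[OF f]) simp
  finally show ?thesis using pos by (simp add: field_simps)
qed

text \<open>The limit is the pointwise one. Each test value depends on finitely many values of the function only,
  so it passes to the limit, and the Cauchy condition bounds all test values of \<open>\<sigma> n - f\<close> at once.\<close>

lemma kernel_space_complete:
  assumes \<sigma>: "\<And>n. \<sigma> n \<in> kernel_space K"
    and cauchy: "\<And>e. 0 < e \<Longrightarrow> \<exists>M. \<forall>m\<ge>M. \<forall>n\<ge>M. kernel_sqnorm K (\<sigma> m - \<sigma> n) \<le> e"
  shows "\<exists>f\<in>kernel_space K. (\<lambda>n. kernel_sqnorm K (\<sigma> n - f)) \<longlonglongrightarrow> 0"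
proof -
  note diff = kernel_space_add_diff(2)
  have "Cauchy (\<lambda>n. \<sigma> n x)" for x
  proof (rule metric_CauchyI)
    fix e :: real assume e: "0 < e"
    have pos: "0 \<le> K x x"
      using positive_kernel_on_nonneg[OF K, of "{x}" "\<lambda>_. 1"] by simp
    obtain M where M: "\<And>m n. \<lbrakk>m \<ge> M; n \<ge> M\<rbrakk> \<Longrightarrow> kernel_sqnorm K (\<sigma> m - \<sigma> n) \<le> e\<^sup>2 / (K x x + 2)"
      using cauchy[of "e\<^sup>2 / (K x x + 2)"] e pos by auto
    have "dist (\<sigma> m x) (\<sigma> n x) < e" if "m \<ge> M" "n \<ge> M" for m n
    proof -
      have "(\<sigma> m x - \<sigma> n x)\<^sup>2 \<le> (K x x + 1) * kernel_sqnorm K (\<sigma> m - \<sigma> n)"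
        using kernel_space_pointwise_bound[OF diff[OF \<sigma> \<sigma>], of m n x] by simp
      also have "\<dots> \<le> (K x x + 1) * (e\<^sup>2 / (K x x + 2))"
        using M[OF that] pos by (intro mult_left_mono) auto
      also have "\<dots> < e\<^sup>2" using e pos by (simp add: field_simps)
      finally have "\<bar>\<sigma> m x - \<sigma> n x\<bar>\<^sup>2 < e\<^sup>2" by (simp only: power2_abs)
      then have "\<bar>\<sigma> m x - \<sigma> n x\<bar> < e" by (rule power_less_imp_less_base) (use e in simp)
      then show ?thesis by (simp add: dist_real_def)
    qed
    then show "\<exists>M. \<forall>m\<ge>M. \<forall>n\<ge>M. dist (\<sigma> m x) (\<sigma> n x) < e" by blast
  qed
  then have "\<exists>l. (\<lambda>n. \<sigma> n x) \<longlonglongrightarrow> l" for x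
    by (simp add: Cauchy_convergent_iff convergent_def)
  then obtain f where f: "\<And>x. (\<lambda>n. \<sigma> n x) \<longlonglongrightarrow> f x" by metis
  have tail: "\<exists>M. \<forall>n\<ge>M. \<sigma> n - f \<in> kernel_space K \<and> kernel_sqnorm K (\<sigma> n - f) \<le> e" if e: "0 < e" for e
  proof -
    obtain M where M: "\<And>m n. \<lbrakk>m \<ge> M; n \<ge> M\<rbrakk> \<Longrightarrow> kernel_sqnorm K (\<sigma> m - \<sigma> n) \<le> e"
      using cauchy[OF e] by blast
    have "kernel_test K (\<sigma> n - f) A c \<le> e" if "n \<ge> M" "finite A" for n A c
    proof (rule LIMSEQ_le_const2)
      show "(\<lambda>m. kernel_test K (\<sigma> n - \<sigma> m) A c) \<longlonglongrightarrow> kernel_test K (\<sigma> n - f) A c"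
        unfolding kernel_test_def by (auto intro!: tendsto_intros f)
      show "\<exists>N. \<forall>m\<ge>N. kernel_test K (\<sigma> n - \<sigma> m) A c \<le> e"
        by (intro exI[of _ M] allI impI order_trans[OF kernel_test_le_sqnorm[OF diff[OF \<sigma> \<sigma>] \<open>finite A\<close>]]
            M[OF \<open>n \<ge> M\<close>])
    qed
    then have "\<sigma> n - f \<in> kernel_space K" "kernel_sqnorm K (\<sigma> n - f) \<le> e" if "n \<ge> M" for n
      using kernel_sqnorm_leI[of K "\<sigma> n - f" e] that by simp_all
    then show ?thesis by (intro exI[of _ M]) simp
  qed
  show ?thesis
  proof
    obtain n where "\<sigma> n - f \<in> kernel_space K" using tail[of 1] by auto
    from diff[OF \<sigma>[of n] this] show "f \<in> kernel_space K" by simp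
    show "(\<lambda>n. kernel_sqnorm K (\<sigma> n - f)) \<longlonglongrightarrow> 0"
    proof (rule metric_LIMSEQ_I)
      fix e :: real assume e: "0 < e"
      then obtain M where M: "\<forall>n\<ge>M. \<sigma> n - f \<in> kernel_space K \<and> kernel_sqnorm K (\<sigma> n - f) \<le> e / 2"
        using tail[of "e / 2"] by auto
      have "dist (kernel_sqnorm K (\<sigma> n - f)) 0 < e" if "n \<ge> M" for n
        using M that kernel_sqnorm_nonneg[of "\<sigma> n - f" K] e by (auto simp: dist_real_def)
      then show "\<exists>M. \<forall>n\<ge>M. dist (kernel_sqnorm K (\<sigma> n - f)) 0 < e" by blast
    qed
  qed
qed

lemma kernel_section_in_space: "K x \<in> kernel_space K"
proof (rule kernel_sqnorm_leI(1))
  fix A :: "'a set" and c :: "'a \<Rightarrow> real" assume A: "finite A"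
  have "(\<Sum>z\<in>A. c z * K z x) = (\<Sum>z\<in>A. c z * K x z)"
    by (intro sum.cong refl arg_cong2[where f = "(*)"] positive_kernel_on_sym[OF K]) auto
  then show "kernel_test K (K x) A c \<le> K x x"
    using positive_kernel_on_move_point[OF K A, of x c 1] by (simp add: kernel_test_def)
qed

text \<open>Completing the square shows that \<open>K x - K y\<close> is tested best by the combination that it is made of,
  \<open>1\<close> at \<open>x\<close> and \<open>-1\<close> at \<open>y\<close>.\<close>

lemma kernel_sqnorm_section_diff:
  "kernel_sqnorm K (K x - K y) = K x x - 2 * K x y + K y y"
proof (cases "x = y")
  case True
  then show ?thesis by (simp add: kernel_space_zero)
next
  case False
  have sym: "K u v = K v u" for u v by (rule positive_kernel_on_sym[OF K]) auto
  define d where "d z = (if z = x then 1 else -1 :: real)" for z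
  show ?thesis
  proof (rule antisym)
    show "kernel_sqnorm K (K x - K y) \<le> K x x - 2 * K x y + K y y"
    proof (rule kernel_sqnorm_leI(2))
      fix A :: "'a set" and c :: "'a \<Rightarrow> real" assume A: "finite A"
      have "(\<Sum>z\<in>A. \<Sum>w\<in>{x, y}. c z * d w * K z w) = (\<Sum>z\<in>A. c z * (K x - K y) z)"
      proof (rule sum.cong[OF refl])
        fix z
        show "(\<Sum>w\<in>{x, y}. c z * d w * K z w) = c z * (K x - K y) z"
          using False sym[of z x] sym[of z y] by (simp add: d_def algebra_simps)
      qed
      moreover have "(\<Sum>z\<in>{x, y}. \<Sum>w\<in>{x, y}. d z * d w * K z w) = K x x - 2 * K x y + K y y"
        using False by (simp add: d_def sym[of y x])
      ultimately show "kernel_test K (K x - K y) A c \<le> K x x - 2 * K x y + K y y"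
        using positive_kernel_on_nonneg_diff[OF K A, of "{x, y}" c d] by (simp add: kernel_test_def)
    qed
    have "K x x - 2 * K x y + K y y = kernel_test K (K x - K y) {x, y} d"
      using False by (simp add: kernel_test_def d_def sym[of y x])
    also have "\<dots> \<le> kernel_sqnorm K (K x - K y)"
      by (intro kernel_test_le_sqnorm kernel_space_add_diff kernel_section_in_space) simp
    finally show "K x x - 2 * K x y + K y y \<le> kernel_sqnorm K (K x - K y)" .
  qed
qed

text \<open>The reproducing kernel Hilbert space: \<open>K\<close> is realised by its own rows.\<close>

lemma kernel_hilbert_space:
  obtains H :: "('a \<Rightarrow> real) inner_space" where "real_hilbert_space H"
    "\<And>x. K x \<in> vectors H" "\<And>x y. vdist H (K x) (K y) = sqrt (K x x - 2 * K x y + K y y)"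
proof -
  let ?N = "kernel_sqnorm K"
  define H where "H = \<lparr>vectors = kernel_space K, vzero = 0, vadd = (+), vscale = (\<lambda>a f x. a * f x),
      vinner = (\<lambda>f g. (?N (f + g) - ?N (f - g)) / 4)\<rparr>"
  have zero: "f = 0" if "f \<in> kernel_space K" "?N f = 0" for f
    using kernel_space_pointwise_bound[OF that(1)] that(2) by (simp add: fun_eq_iff)
  have V: "vectors H = kernel_space K" by (simp add: H_def)
  interpret real_inner_space H
    unfolding H_def
    by (intro real_inner_space_parallelogram(1) kernel_space_zero kernel_space_add_diff kernel_space_scale
        kernel_sqnorm_nonneg zero kernel_sqnorm_parallelogram)
  have dist: "vdist H f g = sqrt (?N (f - g))" if "f \<in> kernel_space K" "g \<in> kernel_space K" for f g
    unfolding H_def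
    by (intro real_inner_space_parallelogram(2) kernel_space_zero kernel_space_add_diff kernel_space_scale
        kernel_sqnorm_nonneg zero kernel_sqnorm_parallelogram that)
  interpret HM: Metric_space "vectors H" "vdist H" by (rule Metric_space_vdist)
  have "HM.mcomplete"
    unfolding HM.mcomplete_def
  proof (intro strip)
    fix \<sigma> assume c: "HM.MCauchy \<sigma>"
    then have \<sigma>H: "\<sigma> n \<in> vectors H" for n
      unfolding HM.MCauchy_def by blast
    then have \<sigma>: "\<sigma> n \<in> kernel_space K" for n
      by (simp add: V)
    have "\<exists>M. \<forall>m\<ge>M. \<forall>n\<ge>M. ?N (\<sigma> m - \<sigma> n) \<le> e" if e: "0 < e" for e
    proof -
      obtain M where "\<And>m n. \<lbrakk>m \<ge> M; n \<ge> M\<rbrakk> \<Longrightarrow> vdist H (\<sigma> m) (\<sigma> n) < sqrt e"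
        using c e unfolding HM.MCauchy_def by (metis real_sqrt_gt_zero)
      then show ?thesis
        using dist[OF \<sigma> \<sigma>] by (intro exI[of _ M]) (simp add: less_imp_le)
    qed
    from kernel_space_complete[OF \<sigma> this] obtain f where f: "f \<in> kernel_space K"
      and lim: "(\<lambda>n. ?N (\<sigma> n - f)) \<longlonglongrightarrow> 0" by blast
    have "(\<lambda>n. vdist H (\<sigma> n) f) \<longlonglongrightarrow> 0"
      using tendsto_real_sqrt[OF lim] by (simp add: dist[OF \<sigma> f])
    then show "\<exists>f. limitin HM.mtopology \<sigma> f sequentially"
      using f[folded V] \<sigma>H unfolding HM.limitin_metric_dist_null by auto
  qed
  then have "real_hilbert_space H"
    by (intro real_hilbert_space.intro real_inner_space_axioms real_hilbert_space_axioms.intro)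
      (simp add: inner_metric_def HM.mcomplete_of)
  then show thesis
    by (rule that) (simp_all add: V dist kernel_section_in_space kernel_sqnorm_section_diff)
qed

end

section \<open>A kernel criterion for coarse embeddability\<close>

lemma positive_kernel_on_realise:
  fixes K :: "'a \<Rightarrow> 'a \<Rightarrow> real"
  assumes K: "positive_kernel_on S K"
  shows "\<exists>(H :: ('a \<Rightarrow> real) inner_space) F. real_hilbert_space H \<and> (\<forall>x. F x \<in> vectors H) \<and>
    (\<forall>x\<in>S. \<forall>y\<in>S. vdist H (F x) (F y) = sqrt (K x x - 2 * K x y + K y y))"
proof -
  define K' where "K' x y = indicat_real S x * indicat_real S y * K x y" for x y
  have "positive_kernel_on UNIV K'"
    unfolding K'_def by (rule positive_kernel_on_scale[OF K]) simp
  then obtain H :: "('a \<Rightarrow> real) inner_space" where "real_hilbert_space H"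
    "\<And>x. K' x \<in> vectors H" "\<And>x y. vdist H (K' x) (K' y) = sqrt (K' x x - 2 * K' x y + K' y y)"
    using kernel_hilbert_space by blast
  then show ?thesis
    by (intro exI[of _ H] exI[of _ K']) (simp add: K'_def)
qed

lemma in_hilbert_families_uniformI:
  fixes \<X> :: "'a metric set" and \<delta> \<rho> :: "real \<Rightarrow> real"
  assumes "metric_family \<X>"
    and ctrl: "\<delta> \<in> {0..} \<rightarrow> {0..}" "\<rho> \<in> {0..} \<rightarrow> {0..}" "mono_on {0..} \<delta>" "mono_on {0..} \<rho>"
      "filterlim \<delta> at_top at_top" "filterlim \<rho> at_top at_top"
    and emb: "\<And>X. X \<in> \<X> \<Longrightarrow> \<exists>(H :: 'h inner_space) f. real_hilbert_space H \<and> (\<forall>x\<in>mspace X. f x \<in> vectors H) \<and>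
      (\<forall>x\<in>mspace X. \<forall>y\<in>mspace X. \<delta> (mdist X x y) \<le> vdist H (f x) (f y) \<and> vdist H (f x) (f y) \<le> \<rho> (mdist X x y))"
  shows "\<X> \<in> hilbert_families"
proof -
  obtain H :: "'a metric \<Rightarrow> 'h inner_space" and f where
    H: "\<And>X. X \<in> \<X> \<Longrightarrow> real_hilbert_space (H X)"
    and f: "\<And>X x. \<lbrakk>X \<in> \<X>; x \<in> mspace X\<rbrakk> \<Longrightarrow> f X x \<in> vectors (H X)"
    and d: "\<And>X x y. \<lbrakk>X \<in> \<X>; x \<in> mspace X; y \<in> mspace X\<rbrakk> \<Longrightarrow>
      \<delta> (mdist X x y) \<le> vdist (H X) (f X x) (f X y) \<and> vdist (H X) (f X x) (f X y) \<le> \<rho> (mdist X x y)"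
    using emb by metis
  have met: "mspace (inner_metric (H X)) = vectors (H X)" "mdist (inner_metric (H X)) = vdist (H X)"
    if "X \<in> \<X>" for X
    using H[OF that, THEN real_hilbert_space.axioms(1)]
    by (simp_all add: real_inner_space.mspace_inner_metric real_inner_space.mdist_inner_metric)
  have "family_map \<X> ((\<lambda>X. inner_metric (H X)) ` \<X>) ((\<lambda>X. (X, f X, inner_metric (H X))) ` \<X>)"
    using f by (auto simp: family_map_def met)
  then have "coarse_embedding \<X> ((\<lambda>X. inner_metric (H X)) ` \<X>) ((\<lambda>X. (X, f X, inner_metric (H X))) ` \<X>)"
    unfolding coarse_embedding_def
    by (intro conjI exI[of _ \<delta>] exI[of _ \<rho>] ctrl) (auto simp: met d)
  then have "hilbert_coarse_embedding \<X> H f"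
    using H by (simp add: hilbert_coarse_embedding_def)
  then show ?thesis
    by (rule in_hilbert_familiesI[OF assms(1)])
qed

lemma hilbert_families_uniformE:
  assumes "\<Y> \<in> hilbert_families"
  obtains H :: "'a metric \<Rightarrow> ('a \<Rightarrow> real) inner_space" and f and \<delta> \<rho> :: "real \<Rightarrow> real" where
    "mono_on {0..} \<rho>" "filterlim \<delta> at_top at_top"
    "\<And>Y. Y \<in> \<Y> \<Longrightarrow> real_inner_space (H Y)"
    "\<And>Y x. \<lbrakk>Y \<in> \<Y>; x \<in> mspace Y\<rbrakk> \<Longrightarrow> f Y x \<in> vectors (H Y)"
    "\<And>Y x y. \<lbrakk>Y \<in> \<Y>; x \<in> mspace Y; y \<in> mspace Y\<rbrakk> \<Longrightarrow>
      \<delta> (mdist Y x y) \<le> vdist (H Y) (f Y x) (f Y y)"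
    "\<And>Y x y. \<lbrakk>Y \<in> \<Y>; x \<in> mspace Y; y \<in> mspace Y\<rbrakk> \<Longrightarrow>
      vdist (H Y) (f Y x) (f Y y) \<le> \<rho> (mdist Y x y)"
proof -
  obtain H :: "'a metric \<Rightarrow> ('a \<Rightarrow> real) inner_space" and f where emb: "hilbert_coarse_embedding \<Y> H f"
    using assms unfolding hilbert_families_def by blast
  have H: "real_inner_space (H Y)" if "Y \<in> \<Y>" for Y
    using emb that unfolding hilbert_coarse_embedding_def by (simp add: real_hilbert_space.axioms(1))
  have met: "mspace (inner_metric (H Y)) = vectors (H Y)" "mdist (inner_metric (H Y)) = vdist (H Y)"
    if "Y \<in> \<Y>" for Y
    using H[OF that] by (simp_all add: real_inner_space.mspace_inner_metric real_inner_space.mdist_inner_metric)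
  obtain \<delta> \<rho> :: "real \<Rightarrow> real" where ctrl: "mono_on {0..} \<rho>" "filterlim \<delta> at_top at_top"
    and d: "\<And>Y x y. \<lbrakk>Y \<in> \<Y>; x \<in> mspace Y; y \<in> mspace Y\<rbrakk> \<Longrightarrow>
      \<delta> (mdist Y x y) \<le> vdist (H Y) (f Y x) (f Y y) \<and> vdist (H Y) (f Y x) (f Y y) \<le> \<rho> (mdist Y x y)"
    using emb unfolding hilbert_coarse_embedding_def coarse_embedding_def by (auto simp: met)
  have "f Y x \<in> vectors (H Y)" if "Y \<in> \<Y>" "x \<in> mspace Y" for Y x
    using emb that unfolding hilbert_coarse_embedding_def coarse_embedding_def family_map_def
    by (auto simp: met Pi_iff)
  then show thesis
    using d by (intro that[of \<rho> \<delta> H f] ctrl H) auto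
qed

text \<open>The criterion explained at the top: a uniformly bounded kernel for each scale suffices, because the
  squared distances for the scales \<open>R = m + 1\<close> and tolerances \<open>2\<^sup>-\<^sup>m\<close> can be summed.\<close>

lemma in_hilbert_families_kernelsI:
  fixes \<X> :: "'a metric set" and C :: real
  assumes fam: "metric_family \<X>" and C: "0 < C"
    and kernels: "\<And>R e. \<lbrakk>0 < R; 0 < e\<rbrakk> \<Longrightarrow> \<exists>T. \<forall>X\<in>\<X>. \<exists>G. positive_kernel_on (mspace X) G \<and>
      (\<forall>x\<in>mspace X. \<forall>y\<in>mspace X. G x x - 2 * G x y + G y y \<le> C \<and>
        (mdist X x y \<le> R \<longrightarrow> G x x - 2 * G x y + G y y \<le> e) \<and>
        (T \<le> mdist X x y \<longrightarrow> 1 \<le> G x x - 2 * G x y + G y y))"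
  shows "\<X> \<in> hilbert_families"
proof -
  have "\<exists>T. \<forall>X\<in>\<X>. \<exists>G. positive_kernel_on (mspace X) G \<and>
      (\<forall>x\<in>mspace X. \<forall>y\<in>mspace X. G x x - 2 * G x y + G y y \<le> C \<and>
        (mdist X x y \<le> real m + 1 \<longrightarrow> G x x - 2 * G x y + G y y \<le> (1/2)^m) \<and>
        (T \<le> mdist X x y \<longrightarrow> 1 \<le> G x x - 2 * G x y + G y y))" for m
    by (rule kernels) simp_all
  then obtain T where T: "\<And>m X. X \<in> \<X> \<Longrightarrow> \<exists>G. positive_kernel_on (mspace X) G \<and>
      (\<forall>x\<in>mspace X. \<forall>y\<in>mspace X. G x x - 2 * G x y + G y y \<le> C \<and>
        (mdist X x y \<le> real m + 1 \<longrightarrow> G x x - 2 * G x y + G y y \<le> (1/2)^m) \<and>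
        (T m \<le> mdist X x y \<longrightarrow> 1 \<le> G x x - 2 * G x y + G y y))"
    by metis
  \<comment> \<open>The condition \<open>real m \<le> t\<close> keeps \<open>L t\<close> finite when the thresholds \<open>T m\<close> are bounded.\<close>
  define L where "L t = {m :: nat. T m \<le> t \<and> real m \<le> t}" for t
  have finL: "finite (L t)" for t
  proof (rule finite_subset)
    show "L t \<subseteq> {..nat \<lceil>t\<rceil>}" by (auto simp: L_def) linarith
  qed simp
  define \<delta> where "\<delta> t = sqrt (card (L t))" for t
  define \<rho> where "\<rho> t = sqrt (C * (t + 1) + 2)" for t
  show ?thesis
  proof (rule in_hilbert_families_uniformI[OF fam, of \<delta> \<rho>])
    show "\<delta> \<in> {0..} \<rightarrow> {0..}" "\<rho> \<in> {0..} \<rightarrow> {0..}"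
      using C by (auto simp: \<delta>_def \<rho>_def)
    show "mono_on {0..} \<delta>"
      by (auto simp: \<delta>_def L_def mono_on_def intro!: card_mono finL[unfolded L_def])
    show "mono_on {0..} \<rho>"
      using C by (auto simp: \<rho>_def mono_on_def)
    show "filterlim \<delta> at_top at_top"
      unfolding filterlim_at_top
    proof
      fix Z
      obtain N where N: "Z\<^sup>2 \<le> real N" using real_arch_simple by blast
      have "Z \<le> \<delta> t" if "Max (insert 0 ((\<lambda>m. max (T m) m) ` {..<N})) \<le> t" for t
      proof -
        have "{..<N} \<subseteq> L t" using that by (auto simp: L_def)
        then have "card {..<N} \<le> card (L t)" by (rule card_mono[OF finL])
        with N have "Z\<^sup>2 \<le> real (card (L t))" by simp
        then show ?thesis unfolding \<delta>_def by (rule real_le_rsqrt)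
      qed
      then show "\<forall>\<^sub>F t in at_top. Z \<le> \<delta> t" by (rule eventually_at_top_linorderI)
    qed
    have "filterlim (\<lambda>t. C * (t + 1) + 2) at_top at_top"
      using C by real_asymp
    then show "filterlim \<rho> at_top at_top"
      unfolding \<rho>_def by (rule filterlim_compose[OF sqrt_at_top])
  next
    fix X assume X: "X \<in> \<X>"
    obtain G where G: "\<And>m. positive_kernel_on (mspace X) (G m)"
      and G': "\<And>m x y. \<lbrakk>x \<in> mspace X; y \<in> mspace X\<rbrakk> \<Longrightarrow> G m x x - 2 * G m x y + G m y y \<le> C \<and>
        (mdist X x y \<le> real m + 1 \<longrightarrow> G m x x - 2 * G m x y + G m y y \<le> (1/2)^m) \<and>
        (T m \<le> mdist X x y \<longrightarrow> 1 \<le> G m x x - 2 * G m x y + G m y y)"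
      using T[OF X] by metis
    define D where "D m x y = G m x x - 2 * G m x y + G m y y" for m x y
    define k where "k x y = (\<Sum>m. D m x y)" for x y
    have D_nonneg: "0 \<le> D m x y" if "x \<in> mspace X" "y \<in> mspace X" for m x y
      using positive_kernel_on_two_points[OF G that, of m 1] by (simp add: D_def)
    have D_C: "D m x y \<le> C" and D_small: "mdist X x y \<le> real m + 1 \<Longrightarrow> D m x y \<le> (1/2)^m"
      and D_large: "T m \<le> mdist X x y \<Longrightarrow> 1 \<le> D m x y"
      if "x \<in> mspace X" "y \<in> mspace X" for m x y
      using G'[OF that, of m] by (auto simp: D_def)
    have summable: "summable (\<lambda>m. D m x y)" if xy: "x \<in> mspace X" "y \<in> mspace X" for x y
    proof (rule summable_comparison_test_ev)
      show "\<forall>\<^sub>F m in sequentially. norm (D m x y) \<le> (1/2)^m"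
      proof (rule eventually_sequentiallyI)
        fix m assume "nat \<lceil>mdist X x y\<rceil> \<le> m"
        then have "mdist X x y \<le> real m + 1" by linarith
        then show "norm (D m x y) \<le> (1/2)^m"
          using D_small[OF xy] D_nonneg[OF xy] by simp
      qed
    qed (simp add: summable_geometric)
    have upper: "k x y \<le> C * (mdist X x y + 1) + 2" if xy: "x \<in> mspace X" "y \<in> mspace X" for x y
    proof -
      define N where "N = nat \<lfloor>mdist X x y\<rfloor>"
      have "D m x y \<le> (if m \<in> {..<N} then C else 0) + (1/2)^m" for m
      proof (cases "m < N")
        case True
        then show ?thesis using D_C[OF xy, of m] by (simp add: add_increasing2)
      next
        case False
        then have "mdist X x y \<le> real m + 1" unfolding N_def by linarith
        then show ?thesis using False D_small[OF xy] by simp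
      qed
      moreover have "(\<lambda>m. (if m \<in> {..<N} then C else 0) + (1/2)^m) sums ((\<Sum>m<N. C) + 1 / (1 - 1/2))"
        by (intro sums_add sums_If_finite_set geometric_sums) simp_all
      ultimately have "k x y \<le> (\<Sum>m<N. C) + 1 / (1 - 1/2)"
        unfolding k_def by (intro sums_le[OF _ summable_sums[OF summable[OF xy]]])
      also have "\<dots> = C * real N + 2" by simp
      also have "\<dots> \<le> C * (mdist X x y + 1) + 2"
        using C unfolding N_def by (intro add_mono mult_left_mono) (simp_all add: add_increasing2)
      finally show ?thesis .
    qed
    have lower: "real (card (L (mdist X x y))) \<le> k x y" if xy: "x \<in> mspace X" "y \<in> mspace X" for x y
    proof -
      have "real (card (L (mdist X x y))) = (\<Sum>m\<in>L (mdist X x y). 1)" by simp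
      also have "\<dots> \<le> (\<Sum>m\<in>L (mdist X x y). D m x y)"
        by (intro sum_mono D_large[OF xy]) (simp add: L_def)
      also have "\<dots> \<le> k x y"
        unfolding k_def by (rule sum_le_suminf[OF summable[OF xy] finL]) (simp add: D_nonneg xy)
      finally show ?thesis .
    qed
    define b where "b = (SOME x. x \<in> mspace X)"
    have b: "b \<in> mspace X" if "x \<in> mspace X" for x
      unfolding b_def using that by (rule someI)
    \<comment> \<open>The Gram kernel with squared distance \<open>k\<close> of a map that sends the base point \<open>b\<close> to \<open>0\<close>; it is
      the limit of sums of the centred kernels.\<close>
    define K where "K x y = (k x b + k b y - k x y) / 2" for x y
    have "positive_kernel_on (mspace X) K"
    proof (rule positive_kernel_on_limit)
      show "positive_kernel_on (mspace X) (\<lambda>x y. \<Sum>m<M. G m x y - G m x b - G m b y + G m b b)" for M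
      proof (cases "mspace X = {}")
        case True
        then show ?thesis by (simp only: positive_kernel_on_empty)
      next
        case False
        then show ?thesis using b by (intro positive_kernel_on_sum positive_kernel_on_centre G) blast
      qed
      show "(\<lambda>M. \<Sum>m<M. G m x y - G m x b - G m b y + G m b b) \<longlonglongrightarrow> K x y"
        if xy: "x \<in> mspace X" "y \<in> mspace X" for x y
      proof -
        have sums: "(\<Sum>m<M. G m x y - G m x b - G m b y + G m b b)
            = ((\<Sum>m<M. D m x b) + (\<Sum>m<M. D m b y) - (\<Sum>m<M. D m x y)) / 2" for M
          unfolding sum.distrib[symmetric] sum_subtractf[symmetric] sum_divide_distrib
          by (intro sum.cong refl) (simp add: D_def field_simps)
        show ?thesis
          unfolding K_def k_def sums
          by (intro tendsto_intros summable_LIMSEQ summable xy b[OF xy(1)]) simp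
      qed
    qed
    then obtain H :: "('a \<Rightarrow> real) inner_space" and F where H: "real_hilbert_space H" "\<And>x. F x \<in> vectors H"
      and dist: "\<And>x y. \<lbrakk>x \<in> mspace X; y \<in> mspace X\<rbrakk> \<Longrightarrow> vdist H (F x) (F y) = sqrt (K x x - 2 * K x y + K y y)"
      using positive_kernel_on_realise by blast
    have "K x x - 2 * K x y + K y y = k x y" if xy: "x \<in> mspace X" "y \<in> mspace X" for x y
    proof -
      have sym: "k u v = k v u" if "u \<in> mspace X" "v \<in> mspace X" for u v
        unfolding k_def D_def using positive_kernel_on_sym[OF G that] by (simp add: algebra_simps)
      have "k u u = 0" for u by (simp add: k_def D_def)
      then show ?thesis
        using sym[OF b[OF xy(1)] xy(1)] sym[OF b[OF xy(1)] xy(2)] by (simp add: K_def field_simps)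
    qed
    then have "vdist H (F x) (F y) = sqrt (k x y)" if "x \<in> mspace X" "y \<in> mspace X" for x y
      using dist that by simp
    then show "\<exists>(H :: ('a \<Rightarrow> real) inner_space) f. real_hilbert_space H \<and> (\<forall>x\<in>mspace X. f x \<in> vectors H) \<and>
      (\<forall>x\<in>mspace X. \<forall>y\<in>mspace X. \<delta> (mdist X x y) \<le> vdist H (f x) (f y) \<and> vdist H (f x) (f y) \<le> \<rho> (mdist X x y))"
      using H upper lower by (intro exI[of _ H] exI[of _ F]) (simp add: \<delta>_def \<rho>_def)
  qed
qed


section \<open>Gluing kernels along a decomposition\<close>

text \<open>The function \<open>x \<mapsto> max 0 (1 - d(x, U) / s)\<close>. It is written as a supremum over \<open>U\<close> that includes the
  value \<open>0\<close>, which covers the empty set.\<close>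

lemma bump_function:
  fixes X :: "'a metric"
  assumes U: "U \<subseteq> mspace X" and s: "0 < s"
  obtains g :: "'a \<Rightarrow> real" where "\<And>x. 0 \<le> g x" "\<And>x. x \<in> mspace X \<Longrightarrow> g x \<le> 1" "\<And>x. x \<in> U \<Longrightarrow> 1 \<le> g x"
    "\<And>x. \<lbrakk>x \<in> mspace X; 0 < g x\<rbrakk> \<Longrightarrow> \<exists>u\<in>U. mdist X x u < s"
    "\<And>x y. \<lbrakk>x \<in> mspace X; y \<in> mspace X\<rbrakk> \<Longrightarrow> \<bar>g x - g y\<bar> \<le> mdist X x y / s"
proof
  define E where "E x = insert 0 ((\<lambda>u. 1 - mdist X x u / s) ` U)" for x
  define g where "g x = Sup (E x)" for x
  have E1: "e \<le> 1" if "e \<in> E x" for e x using that s by (auto simp: E_def)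
  then have le_g: "e \<le> g x" if "e \<in> E x" for e x
    unfolding g_def using that by (intro cSup_upper bdd_aboveI[of _ 1])
  have g_le: "g x \<le> a" if "\<And>e. e \<in> E x \<Longrightarrow> e \<le> a" for x a
    unfolding g_def using that by (intro cSup_least) (auto simp: E_def)
  show "0 \<le> g x" for x by (rule le_g) (simp add: E_def)
  show "g x \<le> 1" for x by (rule g_le) (rule E1)
  show "1 \<le> g x" if "x \<in> U" for x
  proof (rule le_g)
    have "1 = 1 - mdist X x x / s" using that U by auto
    with that show "1 \<in> E x" unfolding E_def by blast
  qed
  show "\<exists>u\<in>U. mdist X x u < s" if "0 < g x" for x
  proof (rule ccontr)
    assume "\<not> (\<exists>u\<in>U. mdist X x u < s)"
    then have "g x \<le> 0" using s by (intro g_le) (auto simp: E_def not_less)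
    with that show False by simp
  qed
  have lip: "g x \<le> g y + mdist X x y / s" if xy: "x \<in> mspace X" "y \<in> mspace X" for x y
  proof (rule g_le)
    fix e assume "e \<in> E x"
    then consider "e = 0" | u where "u \<in> U" "e = 1 - mdist X x u / s" by (auto simp: E_def)
    then show "e \<le> g y + mdist X x y / s"
    proof cases
      case 1
      then show ?thesis using le_g[of 0 y] s by (simp add: E_def)
    next
      case 2
      have "mdist X y u \<le> mdist X x y + mdist X x u"
        using mdist_triangle[of y X x u] xy U 2 by (auto simp: mdist_commute)
      then have "e \<le> (1 - mdist X y u / s) + mdist X x y / s"
        using s 2 by (simp add: field_simps)
      also have "1 - mdist X y u / s \<le> g y" by (rule le_g) (use 2 in \<open>auto simp: E_def\<close>)
      finally show ?thesis by simp
    qed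
  qed
  show "\<bar>g x - g y\<bar> \<le> mdist X x y / s" if "x \<in> mspace X" "y \<in> mspace X" for x y
    using lip[OF that] lip[OF that(2,1)] by (simp add: abs_le_iff mdist_commute)
qed

text \<open>The contribution of a single layer \<open>\<Union>\<U>\<close>: the cut-off \<open>g\<close> and the Gaussian kernel \<open>k\<close> of the
  companion points. Companions in different pieces are more than \<open>r\<close> apart, and moving from points to
  companions changes distances by less than \<open>2 * s\<close>; this is the first alternative in the last
  conclusion.\<close>

lemma layer_kernel:
  fixes X :: "'a metric" and H :: "'a set \<Rightarrow> 'h inner_space"
  assumes s: "0 < s" and t: "0 \<le> t" and disj: "r_disjoint r X \<U>" and sub: "\<And>U. U \<in> \<U> \<Longrightarrow> U \<subseteq> mspace X"
    and H: "\<And>U. U \<in> \<U> \<Longrightarrow> real_inner_space (H U)"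
    and F: "\<And>U x. \<lbrakk>U \<in> \<U>; x \<in> U\<rbrakk> \<Longrightarrow> F U x \<in> vectors (H U)"
  obtains g :: "'a \<Rightarrow> real" and k where
    "positive_kernel_on (mspace X) (\<lambda>x y. g x * g y * k x y)"
    "\<And>x. 0 \<le> g x" "\<And>x. x \<in> mspace X \<Longrightarrow> g x \<le> 1" "\<And>x. x \<in> \<Union>\<U> \<Longrightarrow> 1 \<le> g x"
    "\<And>x y. \<lbrakk>x \<in> mspace X; y \<in> mspace X\<rbrakk> \<Longrightarrow> \<bar>g x - g y\<bar> \<le> mdist X x y / s"
    "\<And>x. \<lbrakk>x \<in> mspace X; 0 < g x\<rbrakk> \<Longrightarrow> k x x = 1"
    "\<And>x y. \<lbrakk>x \<in> mspace X; y \<in> mspace X; 0 < g x; 0 < g y\<rbrakk> \<Longrightarrow>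
      k x y = 0 \<and> r < mdist X x y + 2 * s \<or>
      (\<exists>U\<in>\<U>. \<exists>u\<in>U. \<exists>v\<in>U. mdist X x u < s \<and> mdist X y v < s \<and>
        k x y = exp (- t * (vdist (H U) (F U u) (F U v))\<^sup>2))"
proof -
  have UX: "\<Union>\<U> \<subseteq> mspace X" using sub by blast
  obtain g :: "'a \<Rightarrow> real" where g: "\<And>x. 0 \<le> g x" "\<And>x. x \<in> mspace X \<Longrightarrow> g x \<le> 1" "\<And>x. x \<in> \<Union>\<U> \<Longrightarrow> 1 \<le> g x"
    and near: "\<And>x. \<lbrakk>x \<in> mspace X; 0 < g x\<rbrakk> \<Longrightarrow> \<exists>u\<in>\<Union>\<U>. mdist X x u < s"
    and lip: "\<And>x y. \<lbrakk>x \<in> mspace X; y \<in> mspace X\<rbrakk> \<Longrightarrow> \<bar>g x - g y\<bar> \<le> mdist X x y / s"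
    using bump_function[OF UX s] by blast
  define S where "S = {x \<in> mspace X. 0 < g x}"
  have "\<forall>x. \<exists>u U. x \<in> S \<longrightarrow> U \<in> \<U> \<and> u \<in> U \<and> mdist X x u < s"
    using near by (fastforce simp: S_def)
  then obtain p J where pJ: "\<And>x. x \<in> S \<Longrightarrow> J x \<in> \<U> \<and> p x \<in> J x \<and> mdist X x (p x) < s"
    by metis
  define k where "k x y = (if J x = J y then exp (- t * (vdist (H (J x)) (F (J x) (p x)) (F (J x) (p y)))\<^sup>2) else 0)" for x y
  have "positive_kernel_on S k"
    unfolding k_def
  proof (rule positive_kernel_on_blocks)
    fix U
    show "positive_kernel_on {x \<in> S. J x = U} (\<lambda>x y. exp (- t * (vdist (H U) (F U (p x)) (F U (p y)))\<^sup>2))"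
    proof (cases "U \<in> \<U>")
      case True
      show ?thesis
        by (rule real_inner_space.positive_kernel_on_gaussian[OF H[OF True] _ t]) (use pJ F in auto)
    next
      case False
      with pJ have "{x \<in> S. J x = U} = {}" by auto
      then show ?thesis by (simp only: positive_kernel_on_empty)
    qed
  qed
  then have kernel: "positive_kernel_on (mspace X) (\<lambda>x y. g x * g y * k x y)"
    by (rule positive_kernel_on_scale) (use g(1) in \<open>force simp: S_def not_less antisym\<close>)
  have diag: "k x x = 1" if "x \<in> mspace X" "0 < g x" for x
  proof -
    have x: "J x \<in> \<U>" "p x \<in> J x" using pJ[of x] that by (auto simp: S_def)
    interpret real_inner_space "H (J x)" by (rule H[OF x(1)])
    interpret Metric_space "vectors (H (J x))" "vdist (H (J x))" by (rule Metric_space_vdist)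
    show ?thesis using F[OF x] by (simp add: k_def)
  qed
  have "k x y = 0 \<and> r < mdist X x y + 2 * s \<or>
      (\<exists>U\<in>\<U>. \<exists>u\<in>U. \<exists>v\<in>U. mdist X x u < s \<and> mdist X y v < s \<and>
        k x y = exp (- t * (vdist (H U) (F U u) (F U v))\<^sup>2))"
    if xy: "x \<in> mspace X" "y \<in> mspace X" "0 < g x" "0 < g y" for x y
  proof -
    have x: "J x \<in> \<U>" "p x \<in> J x" "mdist X x (p x) < s" and y: "J y \<in> \<U>" "p y \<in> J y" "mdist X y (p y) < s"
      using pJ[of x] pJ[of y] xy by (auto simp: S_def)
    show ?thesis
    proof (cases "J x = J y")
      case True
      then show ?thesis using x y by (intro disjI2 bexI[of _ "J x"] bexI[of _ "p x"] bexI[of _ "p y"]) (simp_all add: k_def)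
    next
      case False
      have px: "p x \<in> mspace X" and py: "p y \<in> mspace X" using x y sub by auto
      have "ereal r < set_distance X (J x) (J y)"
        using disj False x y by (auto simp: r_disjoint_def)
      also have "\<dots> \<le> ereal (mdist X (p x) (p y))"
        unfolding set_distance_def using INF_lower[of "(p x, p y)" "J x \<times> J y" "\<lambda>(x, y). ereal (mdist X x y)"] x y by simp
      finally have "r < mdist X (p x) (p y)" by simp
      also have "\<dots> \<le> mdist X (p x) x + (mdist X x y + mdist X y (p y))"
        using mdist_triangle[OF px xy(1) py] mdist_triangle[OF xy(1,2) py] by linarith
      also have "\<dots> < mdist X x y + 2 * s" using x y by (simp add: mdist_commute)
      finally show ?thesis using False by (simp add: k_def)
    qed
  qed
  with that[OF kernel g lip diag] show thesis by blast
qed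

text \<open>The sum of the layer kernels over all \<open>i \<le> n\<close>. As \<open>k i x x = 1\<close> wherever \<open>g i x > 0\<close>, its squared distance is
  \<open>\<Sum>i\<le>n. (g i x - g i y)\<^sup>2 + 2 * g i x * g i y * (1 - k i x y)\<close>. At scale \<open>R\<close> the first
  part is small by the Lipschitz condition and the second because \<open>1 - exp (- z) \<le> z\<close>. At large scale
  the bound is read off from \<open>G x x \<ge> 1\<close>, \<open>G y y \<ge> 1\<close> and \<open>G x y \<le> 1/2\<close>.\<close>

lemma decomposition_kernel:
  fixes X :: "'a metric" and H :: "'a set \<Rightarrow> 'h inner_space" and n :: nat and R s t b :: real
  assumes R: "0 \<le> R" and s: "0 < s" and t: "0 \<le> t"
    and cover: "mspace X = (\<Union>i\<le>n. \<Union>(P i))"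
    and disj: "\<And>i. i \<le> n \<Longrightarrow> r_disjoint (R + 2 * s) X (P i)"
    and H: "\<And>i U. \<lbrakk>i \<le> n; U \<in> P i\<rbrakk> \<Longrightarrow> real_inner_space (H U)"
    and F: "\<And>i U x. \<lbrakk>i \<le> n; U \<in> P i; x \<in> U\<rbrakk> \<Longrightarrow> F U x \<in> vectors (H U)"
    and near: "\<And>i U u v. \<lbrakk>i \<le> n; U \<in> P i; u \<in> U; v \<in> U; mdist X u v \<le> R + 2 * s\<rbrakk>
      \<Longrightarrow> vdist (H U) (F U u) (F U v) \<le> b"
    and far: "\<And>i U u v. \<lbrakk>i \<le> n; U \<in> P i; u \<in> U; v \<in> U; q \<le> mdist X u v\<rbrakk>
      \<Longrightarrow> exp (- t * (vdist (H U) (F U u) (F U v))\<^sup>2) \<le> 1 / (2 * (real n + 1))"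
  obtains G where "positive_kernel_on (mspace X) G"
    "\<And>x y. \<lbrakk>x \<in> mspace X; y \<in> mspace X\<rbrakk> \<Longrightarrow> G x x - 2 * G x y + G y y \<le> 3 * (real n + 1)"
    "\<And>x y. \<lbrakk>x \<in> mspace X; y \<in> mspace X; mdist X x y \<le> R\<rbrakk>
      \<Longrightarrow> G x x - 2 * G x y + G y y \<le> (real n + 1) * ((R / s)\<^sup>2 + 2 * (t * b\<^sup>2))"
    "\<And>x y. \<lbrakk>x \<in> mspace X; y \<in> mspace X; q + 2 * s \<le> mdist X x y\<rbrakk>
      \<Longrightarrow> 1 \<le> G x x - 2 * G x y + G y y"
proof -
  have sub: "U \<subseteq> mspace X" if "i \<le> n" "U \<in> P i" for i U
    unfolding cover using that by blast
  define layer where "layer i g k \<longleftrightarrow> positive_kernel_on (mspace X) (\<lambda>x y. g x * g y * k x y) \<and>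
    (\<forall>x. 0 \<le> g x) \<and> (\<forall>x\<in>mspace X. g x \<le> 1) \<and> (\<forall>x\<in>\<Union>(P i). 1 \<le> g x) \<and>
    (\<forall>x\<in>mspace X. \<forall>y\<in>mspace X. \<bar>g x - g y\<bar> \<le> mdist X x y / s) \<and>
    (\<forall>x\<in>mspace X. 0 < g x \<longrightarrow> k x x = 1) \<and>
    (\<forall>x\<in>mspace X. \<forall>y\<in>mspace X. 0 < g x \<longrightarrow> 0 < g y \<longrightarrow>
      k x y = 0 \<and> R + 2 * s < mdist X x y + 2 * s \<or>
      (\<exists>U\<in>P i. \<exists>u\<in>U. \<exists>v\<in>U. mdist X x u < s \<and> mdist X y v < s \<and>
        k x y = exp (- t * (vdist (H U) (F U u) (F U v))\<^sup>2)))" for i and g :: "'a \<Rightarrow> real" and k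
  have "\<exists>g k. layer i g k" if i: "i \<le> n" for i
    by (rule layer_kernel[OF s t disj[OF i] sub[OF i] H[OF i] F[OF i]])
      (assumption+, simp only: layer_def, blast)
  then obtain g k where layer: "\<And>i. i \<le> n \<Longrightarrow> layer i (g i) (k i)"
    by metis
  have kernel: "positive_kernel_on (mspace X) (\<lambda>x y. g i x * g i y * k i x y)"
    and g0: "\<And>x. 0 \<le> g i x" and g1: "\<And>x. x \<in> mspace X \<Longrightarrow> g i x \<le> 1"
    and g_piece: "\<And>x. x \<in> \<Union>(P i) \<Longrightarrow> 1 \<le> g i x"
    and lip: "\<And>x y. \<lbrakk>x \<in> mspace X; y \<in> mspace X\<rbrakk> \<Longrightarrow> \<bar>g i x - g i y\<bar> \<le> mdist X x y / s"
    and diag: "\<And>x. \<lbrakk>x \<in> mspace X; 0 < g i x\<rbrakk> \<Longrightarrow> k i x x = 1"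
    and off: "\<And>x y. \<lbrakk>x \<in> mspace X; y \<in> mspace X; 0 < g i x; 0 < g i y\<rbrakk> \<Longrightarrow>
      k i x y = 0 \<and> R + 2 * s < mdist X x y + 2 * s \<or>
      (\<exists>U\<in>P i. \<exists>u\<in>U. \<exists>v\<in>U. mdist X x u < s \<and> mdist X y v < s \<and>
        k i x y = exp (- t * (vdist (H U) (F U u) (F U v))\<^sup>2))" if i: "i \<le> n" for i
    using layer[OF i] unfolding layer_def by simp_all blast
  define G where "G x y = (\<Sum>i\<le>n. g i x * g i y * k i x y)" for x y
  have psd: "positive_kernel_on (mspace X) G"
    unfolding G_def by (rule positive_kernel_on_sum) (simp add: kernel)
  have diag': "g i x * g i x * k i x x = (g i x)\<^sup>2" if "i \<le> n" "x \<in> mspace X" for i x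
    using diag[OF that] g0[OF that(1), of x] by (cases "g i x = 0") (auto simp: power2_eq_square)
  have G_diag: "G x x = (\<Sum>i\<le>n. (g i x)\<^sup>2)" if "x \<in> mspace X" for x
    unfolding G_def by (intro sum.cong refl diag') (use that in auto)
  have D: "G x x - 2 * G x y + G y y = (\<Sum>i\<le>n. (g i x - g i y)\<^sup>2 + 2 * (g i x * g i y * (1 - k i x y)))"
    if "x \<in> mspace X" "y \<in> mspace X" for x y
    unfolding G_diag[OF that(1)] G_diag[OF that(2)] unfolding G_def sum_distrib_left
      sum_subtractf[symmetric] sum.distrib[symmetric]
    by (intro sum.cong refl) (simp add: power2_eq_square algebra_simps)
  have k01: "0 \<le> k i x y \<and> k i x y \<le> 1" if "i \<le> n" "x \<in> mspace X" "y \<in> mspace X" "0 < g i x" "0 < g i y" for i x y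
    using off[OF that] t by auto
  have gg: "0 \<le> g i x * g i y" "g i x * g i y \<le> 1" if "i \<le> n" "x \<in> mspace X" "y \<in> mspace X" for i x y
    using g0[OF that(1)] g1[OF that(1)] that by (auto intro: mult_le_one)
  have zero: "g i x * g i y = 0 \<or> 0 < g i x \<and> 0 < g i y" if "i \<le> n" for i x y
    using g0[OF that, of x] g0[OF that, of y] by (auto simp: less_le)
  show thesis
  proof (rule that[OF psd])
    fix x y assume xy: "x \<in> mspace X" "y \<in> mspace X"
    have "(g i x - g i y)\<^sup>2 + 2 * (g i x * g i y * (1 - k i x y)) \<le> 3" if i: "i \<le> n" for i
    proof -
      have "\<bar>g i x - g i y\<bar> \<le> 1"
        using g0[OF i, of x] g0[OF i, of y] g1[OF i xy(1)] g1[OF i xy(2)] by (simp add: abs_le_iff)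
      then have "(g i x - g i y)\<^sup>2 \<le> 1" by (simp add: abs_square_le_1)
      moreover have "g i x * g i y * (1 - k i x y) \<le> 1"
      proof (cases "g i x * g i y = 0")
        case True
        then show ?thesis by (simp only: mult_zero_left zero_le_one)
      next
        case False
        then have "0 < g i x" "0 < g i y" using zero[OF i, of x y] by auto
        then show ?thesis using k01[OF i xy] by (intro mult_le_one[OF gg(2)[OF i xy]]) simp_all
      qed
      ultimately show ?thesis by simp
    qed
    then have "(\<Sum>i\<le>n. (g i x - g i y)\<^sup>2 + 2 * (g i x * g i y * (1 - k i x y))) \<le> (\<Sum>i\<le>n. 3)"
      by (intro sum_mono) simp
    then show "G x x - 2 * G x y + G y y \<le> 3 * (real n + 1)"
      unfolding D[OF xy] by simp
  next
    fix x y assume xy: "x \<in> mspace X" "y \<in> mspace X" and d: "mdist X x y \<le> R"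
    have "(g i x - g i y)\<^sup>2 + 2 * (g i x * g i y * (1 - k i x y)) \<le> (R / s)\<^sup>2 + 2 * (t * b\<^sup>2)" if i: "i \<le> n" for i
    proof -
      have "\<bar>g i x - g i y\<bar> \<le> R / s"
        using lip[OF i xy] d s by (meson divide_right_mono less_imp_le order_trans)
      then have "(g i x - g i y)\<^sup>2 \<le> (R / s)\<^sup>2"
        by (metis abs_ge_zero power2_abs power_mono)
      moreover have "g i x * g i y * (1 - k i x y) \<le> t * b\<^sup>2"
      proof (cases "g i x * g i y = 0")
        case True
        then show ?thesis using t by (simp only: mult_zero_left zero_le_mult_iff zero_le_power2 simp_thms)
      next
        case False
        then have pos: "0 < g i x" "0 < g i y" using zero[OF i, of x y] by auto
        with off[OF i xy] d obtain U u v where U: "U \<in> P i" "u \<in> U" "v \<in> U"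
          and uv: "mdist X x u < s" "mdist X y v < s"
          and k: "k i x y = exp (- t * (vdist (H U) (F U u) (F U v))\<^sup>2)" by auto
        have u: "u \<in> mspace X" and v: "v \<in> mspace X" using sub[OF i U(1)] U by auto
        have "mdist X u v \<le> mdist X u x + (mdist X x y + mdist X y v)"
          using mdist_triangle[OF u xy(1) v] mdist_triangle[OF xy v] by linarith
        also have "\<dots> \<le> R + 2 * s" using d uv by (simp add: mdist_commute)
        finally have le: "vdist (H U) (F U u) (F U v) \<le> b" by (rule near[OF i U])
        interpret real_inner_space "H U" by (rule H[OF i U(1)])
        interpret Metric_space "vectors (H U)" "vdist (H U)" by (rule Metric_space_vdist)
        have "(vdist (H U) (F U u) (F U v))\<^sup>2 \<le> b\<^sup>2"
          by (rule power_mono[OF le]) (rule nonneg)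
        then have "t * (vdist (H U) (F U u) (F U v))\<^sup>2 \<le> t * b\<^sup>2"
          using t by (rule mult_left_mono)
        then have "1 - k i x y \<le> t * b\<^sup>2"
          using exp_ge_add_one_self[of "- t * (vdist (H U) (F U u) (F U v))\<^sup>2"] by (simp add: k)
        moreover have "g i x * g i y * (1 - k i x y) \<le> 1 * (1 - k i x y)"
          by (rule mult_right_mono) (use gg[OF i xy] k01[OF i xy pos] in auto)
        ultimately show ?thesis by simp
      qed
      ultimately show ?thesis by simp
    qed
    then have "(\<Sum>i\<le>n. (g i x - g i y)\<^sup>2 + 2 * (g i x * g i y * (1 - k i x y))) \<le> (\<Sum>i\<le>n. (R / s)\<^sup>2 + 2 * (t * b\<^sup>2))"
      by (intro sum_mono) simp
    then show "G x x - 2 * G x y + G y y \<le> (real n + 1) * ((R / s)\<^sup>2 + 2 * (t * b\<^sup>2))"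
      unfolding D[OF xy] by (simp add: add.commute)
  next
    fix x y assume xy: "x \<in> mspace X" "y \<in> mspace X" and d: "q + 2 * s \<le> mdist X x y"
    have G1: "1 \<le> G x x" if x: "x \<in> mspace X" for x
    proof -
      obtain i where i: "i \<le> n" "x \<in> \<Union>(P i)" using x unfolding cover by auto
      have "1 \<le> (g i x)\<^sup>2" using g_piece[OF i] by simp
      also have "\<dots> \<le> (\<Sum>i\<le>n. (g i x)\<^sup>2)" by (rule member_le_sum) (use i in auto)
      finally show ?thesis by (simp add: G_diag[OF x])
    qed
    have "g i x * g i y * k i x y \<le> 1 / (2 * (real n + 1))" if i: "i \<le> n" for i
    proof (cases "g i x * g i y = 0")
      case True
      then show ?thesis by (simp only: mult_zero_left zero_le_divide_1_iff) simp
    next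
      case False
      then have pos: "0 < g i x" "0 < g i y" using zero[OF i, of x y] by auto
      have "k i x y \<le> 1 / (2 * (real n + 1))"
      proof (cases "k i x y = 0")
        case False
        with off[OF i xy pos] obtain U u v where U: "U \<in> P i" "u \<in> U" "v \<in> U"
          and uv: "mdist X x u < s" "mdist X y v < s"
          and k: "k i x y = exp (- t * (vdist (H U) (F U u) (F U v))\<^sup>2)" by auto
        have u: "u \<in> mspace X" and v: "v \<in> mspace X" using sub[OF i U(1)] U by auto
        have "mdist X x y \<le> mdist X x u + (mdist X u v + mdist X v y)"
          using mdist_triangle[OF xy(1) u xy(2)] mdist_triangle[OF u v xy(2)] by linarith
        then have "q \<le> mdist X u v" using d uv by (simp add: mdist_commute)
        then show ?thesis unfolding k by (rule far[OF i U])
      qed simp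
      moreover have "g i x * g i y * k i x y \<le> 1 * k i x y"
        by (rule mult_right_mono) (use gg[OF i xy] k01[OF i xy pos] in auto)
      ultimately show ?thesis by simp
    qed
    then have "G x y \<le> (\<Sum>i\<le>n. 1 / (2 * (real n + 1)))"
      unfolding G_def by (intro sum_mono) simp
    also have "\<dots> = 1 / 2" by (simp add: field_simps)
    finally show "1 \<le> G x x - 2 * G x y + G y y" using G1[OF xy(1)] G1[OF xy(2)] by simp
  qed
qed

theorem theorem3p6:
  fixes n :: nat and \<X> :: "'a metric set"
  assumes "metric_family \<X>"
    and "n_decomposable n \<X> hilbert_families"
  shows "\<X> \<in> hilbert_families"
proof (rule in_hilbert_families_kernelsI[OF assms(1), of "3 * (real n + 1)"])
  fix R e :: real assume R: "0 < R" and e: "0 < e"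
  \<comment> \<open>The parameters \<open>s\<close> and \<open>t\<close> are chosen so that each of the \<open>n + 1\<close> layers contributes at most
    \<open>\<eta>\<close> through the cut-off functions and at most \<open>\<eta>\<close> through the Gaussian kernel, \<open>2 * \<eta> * (n + 1) = e\<close>
    in total.\<close>
  define \<eta> where "\<eta> = e / (2 * (real n + 1))"
  have \<eta>: "0 < \<eta>" using e by (simp add: \<eta>_def)
  define s where "s = R / sqrt \<eta>"
  define r where "r = R + 2 * s"
  have s: "0 < s" using R \<eta> by (simp add: s_def)
  with R have r: "0 < r" by (simp add: r_def)
  obtain \<Y> where \<Y>: "\<Y> \<in> hilbert_families" and dec: "rn_decomposable r n \<X> \<Y>"
    using assms(2) r unfolding n_decomposable_def by blast
  obtain \<rho> \<delta> :: "real \<Rightarrow> real" and H :: "'a metric \<Rightarrow> ('a \<Rightarrow> real) inner_space" and f where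
    \<rho>_mono: "mono_on {0..} \<rho>" and \<delta>_lim: "filterlim \<delta> at_top at_top"
    and H: "\<And>Y. Y \<in> \<Y> \<Longrightarrow> real_inner_space (H Y)"
    and f: "\<And>Y x. \<lbrakk>Y \<in> \<Y>; x \<in> mspace Y\<rbrakk> \<Longrightarrow> f Y x \<in> vectors (H Y)"
    and lower: "\<And>Y x y. \<lbrakk>Y \<in> \<Y>; x \<in> mspace Y; y \<in> mspace Y\<rbrakk> \<Longrightarrow>
      \<delta> (mdist Y x y) \<le> vdist (H Y) (f Y x) (f Y y)"
    and upper: "\<And>Y x y. \<lbrakk>Y \<in> \<Y>; x \<in> mspace Y; y \<in> mspace Y\<rbrakk> \<Longrightarrow>
      vdist (H Y) (f Y x) (f Y y) \<le> \<rho> (mdist Y x y)"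
    by (rule hilbert_families_uniformE[OF \<Y>]) (rule that; assumption)
  define t where "t = \<eta> / (2 * ((\<rho> r)\<^sup>2 + 1))"
  have t: "0 < t" using \<eta> by (simp add: t_def add_nonneg_pos)
  have t\<rho>: "2 * (t * (\<rho> r)\<^sup>2) \<le> \<eta>"
    using \<eta> by (simp add: t_def divide_simps add_nonneg_pos)
  \<comment> \<open>As \<open>v \<le> v\<^sup>2\<close> for \<open>v \<ge> 1\<close>, the bound \<open>B \<le> v\<close> makes \<open>t * v\<^sup>2\<close> large enough.\<close>
  define B where "B = max 1 (ln (2 * (real n + 1)) / t)"
  obtain q where q: "\<And>z. q \<le> z \<Longrightarrow> B \<le> \<delta> z"
    using \<delta>_lim unfolding filterlim_at_top eventually_at_top_linorder by blast
  have decay: "exp (- t * v\<^sup>2) \<le> 1 / (2 * (real n + 1))" if "B \<le> v" for v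
  proof -
    have "1 \<le> v" "ln (2 * (real n + 1)) / t \<le> v" using that by (simp_all add: B_def)
    then have "ln (2 * (real n + 1)) / t \<le> v\<^sup>2"
      using self_le_power[of v 2] by simp
    then have "ln (2 * (real n + 1)) \<le> t * v\<^sup>2"
      using t by (simp add: field_simps)
    then have "exp (- t * v\<^sup>2) \<le> exp (- ln (2 * (real n + 1)))" by simp
    also have "\<dots> = 1 / (2 * (real n + 1))" by (simp add: exp_minus divide_inverse)
    finally show ?thesis .
  qed
  show "\<exists>T. \<forall>X\<in>\<X>. \<exists>G. positive_kernel_on (mspace X) G \<and>
      (\<forall>x\<in>mspace X. \<forall>y\<in>mspace X. G x x - 2 * G x y + G y y \<le> 3 * (real n + 1) \<and>
        (mdist X x y \<le> R \<longrightarrow> G x x - 2 * G x y + G y y \<le> e) \<and>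
        (T \<le> mdist X x y \<longrightarrow> 1 \<le> G x x - 2 * G x y + G y y))"
  proof (intro exI[of _ "q + 2 * s"] ballI)
    fix X assume "X \<in> \<X>"
    then obtain P :: "nat \<Rightarrow> 'a set set" where cover: "mspace X = (\<Union>i\<le>n. \<Union>(P i))"
      and disj: "\<And>i. i \<le> n \<Longrightarrow> r_disjoint (R + 2 * s) X (P i)"
      and sub: "\<And>i U. \<lbrakk>i \<le> n; U \<in> P i\<rbrakk> \<Longrightarrow> submetric X U \<in> \<Y>"
      using dec unfolding rn_decomposable_def r_def by metis
    have space: "mspace (submetric X U) = U" if "i \<le> n" "U \<in> P i" for i U
      using that cover by auto
    obtain G where G: "positive_kernel_on (mspace X) G"
      "\<And>x y. \<lbrakk>x \<in> mspace X; y \<in> mspace X\<rbrakk> \<Longrightarrow> G x x - 2 * G x y + G y y \<le> 3 * (real n + 1)"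
      and small: "\<And>x y. \<lbrakk>x \<in> mspace X; y \<in> mspace X; mdist X x y \<le> R\<rbrakk>
        \<Longrightarrow> G x x - 2 * G x y + G y y \<le> (real n + 1) * ((R / s)\<^sup>2 + 2 * (t * (\<rho> r)\<^sup>2))"
      and large: "\<And>x y. \<lbrakk>x \<in> mspace X; y \<in> mspace X; q + 2 * s \<le> mdist X x y\<rbrakk>
        \<Longrightarrow> 1 \<le> G x x - 2 * G x y + G y y"
    proof (rule decomposition_kernel[OF less_imp_le[OF R] s less_imp_le[OF t] cover disj,
          of "\<lambda>U. H (submetric X U)" "\<lambda>U. f (submetric X U)" "\<rho> r" q])
      show "real_inner_space (H (submetric X U))" if "i \<le> n" "U \<in> P i" for i U
        by (rule H[OF sub[OF that]])
      show "f (submetric X U) x \<in> vectors (H (submetric X U))" if "i \<le> n" "U \<in> P i" "x \<in> U" for i U x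
        using f[OF sub[OF that(1,2)]] that(3) unfolding space[OF that(1,2)] .
      show "vdist (H (submetric X U)) (f (submetric X U) u) (f (submetric X U) v) \<le> \<rho> r"
        if "i \<le> n" "U \<in> P i" "u \<in> U" "v \<in> U" "mdist X u v \<le> R + 2 * s" for i U u v
      proof -
        have "vdist (H (submetric X U)) (f (submetric X U) u) (f (submetric X U) v) \<le> \<rho> (mdist X u v)"
          using upper[OF sub[OF that(1,2)], unfolded space[OF that(1,2)], OF that(3,4)] by simp
        also have "\<dots> \<le> \<rho> r"
          by (rule mono_onD[OF \<rho>_mono]) (use that(5) r in \<open>auto simp: r_def\<close>)
        finally show ?thesis .
      qed
      show "exp (- t * (vdist (H (submetric X U)) (f (submetric X U) u) (f (submetric X U) v))\<^sup>2)
          \<le> 1 / (2 * (real n + 1))"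
        if "i \<le> n" "U \<in> P i" "u \<in> U" "v \<in> U" "q \<le> mdist X u v" for i U u v
      proof (rule decay)
        have "\<delta> (mdist X u v) \<le> vdist (H (submetric X U)) (f (submetric X U) u) (f (submetric X U) v)"
          using lower[OF sub[OF that(1,2)], unfolded space[OF that(1,2)], OF that(3,4)] by simp
        with q[OF that(5)] show "B \<le> vdist (H (submetric X U)) (f (submetric X U) u) (f (submetric X U) v)"
          by simp
      qed
    qed (assumption+, blast)
    have "(R / s)\<^sup>2 = \<eta>" using R \<eta> by (simp add: s_def)
    with t\<rho> have "(real n + 1) * ((R / s)\<^sup>2 + 2 * (t * (\<rho> r)\<^sup>2)) \<le> (real n + 1) * (2 * \<eta>)"
      by (intro mult_left_mono) auto
    also have "\<dots> = e" by (simp add: \<eta>_def field_simps)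
    finally have "G x x - 2 * G x y + G y y \<le> e" if "x \<in> mspace X" "y \<in> mspace X" "mdist X x y \<le> R" for x y
      using small[OF that] by simp
    with G large show "\<exists>G. positive_kernel_on (mspace X) G \<and>
      (\<forall>x\<in>mspace X. \<forall>y\<in>mspace X. G x x - 2 * G x y + G y y \<le> 3 * (real n + 1) \<and>
        (mdist X x y \<le> R \<longrightarrow> G x x - 2 * G x y + G y y \<le> e) \<and>
        (q + 2 * s \<le> mdist X x y \<longrightarrow> 1 \<le> G x x - 2 * G x y + G y y))"
      by (intro exI[of _ G]) simp
  qed
qed simp

end
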